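(* Let $G\subseteq \mathrm{GL}(V)$ be a finite group generated by reflections of order $2$, where $V\cong\mathbb{C}^n$, let $S=\mathrm{Sym}_{\mathbb{C}}(V)\cong\mathbb{C}[x_1,\dots,x_n]$, let $\Gamma=G\cap\mathrm{SL}(V)$, $R=S^\Gamma$, and let $H\cong G/\Gamma\cong\mu_2$, realized as the subgroup $H=\langle\sigma\rangle\subseteq G$ generated by a reflection $\sigma\in G$. Then there is an isomorphism of rings $$\mathrm{End}_{R*H}(S*H)\;\cong\;S*G .$$
   Context: The base field is $\mathbb{C}$. A reflection (of order 2) is an element of $\mathrm{GL}(V)$ conjugate to $\mathrm{diag}(-1,1,\dots,1)$. $G$ is finite and nontrivial, generated by such elements. $G$ acts on $S$ by graded ring automorphisms extending its action on $V$. Since $\Gamma$ is normal of index $2$ in $G$, there is an exact sequence $1\to\Gamma\to G\to H\to 1$ with $H\cong\mu_2=\langle\sigma\rangle$, and any reflection $\sigma\in G$ gives a splitting. $H=\langle\sigma\rangle$ acts on $S$ and (by restriction) on $R=S^\Gamma$. For a group $K$ acting on a commutative ring $P$, the skew (twisted) group ring $P*K$ is $P\otimes_{\mathbb{Z}}\mathbb{Z}K$ as a $P$-module, with multiplication $(pg)(p'g')=(p\,g(p'))(gg')$ for $p,p'\in P$, $g,g'\in K$. The ring $S*H$ is regarded as a right $R*H$-module via the inclusion of rings $R*H\subseteq S*H$. *)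

theory Defs
  imports
    "HOL-Analysis.Determinants"
    "HOL-Library.Poly_Mapping"
    "HOL-Algebra.Algebra"
    "HOL-Algebra.Algebraic_Closure_Type"
begin

section \<open>Linear groups and reflections\<close>

definition GL :: "(complex^'n^'n) monoid" where
  "GL = \<lparr>carrier = {A. invertible A}, monoid.mult = (**), one = mat 1\<rparr>"

definition SL :: "(complex^'n^'n) set" where
  "SL = {A. det A = 1}"

text \<open>A reflection (of order 2) is conjugate to \<open>diag(-1,1,\<dots>,1)\<close>. The index type carries no
  order, so the position \<open>k\<close> of the entry \<open>-1\<close> is left open; all positions give conjugate
  matrices.\<close>

definition is_reflection :: "complex^'n^'n \<Rightarrow> bool" where
  "is_reflection A \<longleftrightarrow>
     (\<exists>(P :: complex^'n^'n) k. invertible P \<and>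
        A = P ** (\<chi> i j. if i = j then (if i = k then -1 else 1) else 0) ** matrix_inv P)"


section \<open>The symmetric algebra of \<open>V\<close>, with its linear action\<close>

text \<open>\<open>Sym(V)\<close> for \<open>V = complex^'n\<close> is the polynomial ring on variables \<open>x\<^sub>i\<close>, where \<open>x\<^sub>i\<close> is the
  \<open>i\<close>-th standard basis vector of \<open>V\<close> (not a coordinate function on \<open>V\<close>). The exponent vectors are
  the elements of \<open>'n \<Rightarrow>\<^sub>0 nat\<close>.\<close>

type_synonym 'n sym = "('n \<Rightarrow>\<^sub>0 nat) \<Rightarrow>\<^sub>0 complex"

definition var :: "'n \<Rightarrow> 'n sym" where
  "var i = Poly_Mapping.single (Poly_Mapping.single i 1) 1"

definition const :: "complex \<Rightarrow> 'n sym" where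
  "const c = Poly_Mapping.single 0 c"

text \<open>The algebra endomorphism extending \<open>A\<close> on \<open>V\<close>: it sends \<open>x\<^sub>i\<close> to the \<open>i\<close>-th column
  \<open>\<Sum>j. A\<^sub>j\<^sub>i x\<^sub>j\<close> of \<open>A\<close>, so that \<open>A \<mapsto> sym_act A\<close> is a left action.\<close>

definition sym_act :: "complex^'n^'n \<Rightarrow> 'n sym \<Rightarrow> 'n sym" where
  "sym_act A p =
     (\<Sum>m \<in> Poly_Mapping.keys p. const (Poly_Mapping.lookup p m) *
        (\<Prod>i\<in>UNIV. (\<Sum>j\<in>UNIV. const (A $ j $ i) * var j) ^ Poly_Mapping.lookup m i))"

definition invariant_ring ::
    "('p, 'x) ring_scheme \<Rightarrow> 'g set \<Rightarrow> ('g \<Rightarrow> 'p \<Rightarrow> 'p) \<Rightarrow> ('p, 'x) ring_scheme" where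
  "invariant_ring P \<Gamma> act = P\<lparr>carrier := {p \<in> carrier P. \<forall>g\<in>\<Gamma>. act g p = p}\<rparr>"


section \<open>Skew group rings and endomorphism rings\<close>

text \<open>The element \<open>\<Sum>g. p\<^sub>g g\<close> of \<open>P * K\<close> is represented by its coefficient function \<open>g \<mapsto> p\<^sub>g\<close> on
  \<open>carrier K\<close>. Extending \<open>(p g) (p' g') = (p g(p')) (g g')\<close> biadditively, the coefficient of \<open>k\<close> in
  a product collects the pairs \<open>(g, g\<inverse> k)\<close>. If \<open>Q\<close> is a \<open>K\<close>-stable subring of \<open>P\<close> with the
  operations of \<open>P\<close>, then \<open>Q * K\<close> is literally a subring of \<open>P * K\<close>.\<close>

definition skew_group_ring ::
    "('p, 'x) ring_scheme \<Rightarrow> ('g, 'y) monoid_scheme \<Rightarrow> ('g \<Rightarrow> 'p \<Rightarrow> 'p) \<Rightarrow> ('g \<Rightarrow> 'p) ring" where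
  "skew_group_ring P K act =
    \<lparr>carrier = {f \<in> carrier K \<rightarrow>\<^sub>E carrier P. finite {g \<in> carrier K. f g \<noteq> \<zero>\<^bsub>P\<^esub>}},
     monoid.mult = (\<lambda>f f'. \<lambda>k\<in>carrier K.
       \<Oplus>\<^bsub>P\<^esub>g\<in>{g \<in> carrier K. f g \<noteq> \<zero>\<^bsub>P\<^esub>}. f g \<otimes>\<^bsub>P\<^esub> act g (f' (inv\<^bsub>K\<^esub> g \<otimes>\<^bsub>K\<^esub> k))),
     one = (\<lambda>k\<in>carrier K. if k = \<one>\<^bsub>K\<^esub> then \<one>\<^bsub>P\<^esub> else \<zero>\<^bsub>P\<^esub>),
     ring.zero = (\<lambda>k\<in>carrier K. \<zero>\<^bsub>P\<^esub>),
     add = (\<lambda>f f'. \<lambda>k\<in>carrier K. f k \<oplus>\<^bsub>P\<^esub> f' k)\<rparr>"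

text \<open>The ring of endomorphisms of a right \<open>A\<close>-module: \<open>M\<close> supplies the additive group (its
  multiplication is not used) and \<open>smul m a\<close> is \<open>m a\<close>. The product is composition
  \<open>\<phi> \<circ> \<psi>\<close>, i.e. endomorphisms are written on the left.\<close>

definition right_module_End ::
    "('m, 'x) ring_scheme \<Rightarrow> ('a, 'y) ring_scheme \<Rightarrow> ('m \<Rightarrow> 'a \<Rightarrow> 'm) \<Rightarrow> ('m \<Rightarrow> 'm) ring" where
  "right_module_End M A smul =
    \<lparr>carrier = {\<phi> \<in> carrier M \<rightarrow>\<^sub>E carrier M.
       (\<forall>x\<in>carrier M. \<forall>y\<in>carrier M. \<phi> (x \<oplus>\<^bsub>M\<^esub> y) = \<phi> x \<oplus>\<^bsub>M\<^esub> \<phi> y) \<and>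
       (\<forall>x\<in>carrier M. \<forall>a\<in>carrier A. \<phi> (smul x a) = smul (\<phi> x) a)},
     monoid.mult = (\<lambda>\<phi> \<psi>. compose (carrier M) \<phi> \<psi>),
     one = (\<lambda>x\<in>carrier M. x),
     ring.zero = (\<lambda>x\<in>carrier M. \<zero>\<^bsub>M\<^esub>),
     add = (\<lambda>\<phi> \<psi>. \<lambda>x\<in>carrier M. \<phi> x \<oplus>\<^bsub>M\<^esub> \<psi> x)\<rparr>"

end

theory Submission
  imports Defs
begin

text \<open>Write \<open>\<pi> : G \<rightarrow> H\<close> for the retraction with kernel \<open>\<Gamma>\<close>. Then \<open>S * G\<close> acts on the left of
  \<open>S * H\<close> by \<open>(s g) (s' h) = s g(s') \<pi>(g) h\<close>, and this commutes with right multiplication by \<open>R * H\<close>.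
  An endomorphism \<open>\<phi>\<close> is determined by its coefficient maps \<open>s \<mapsto> \<phi>(s)\<^sub>h\<close> on \<open>S\<close>, which become
  \<open>R\<close>-linear after composition with \<open>h\<close>, so everything reduces to Auslander's theorem: every
  \<open>R\<close>-linear map \<open>S \<rightarrow> S\<close> is a combination \<open>\<Sum>\<gamma>\<in>\<Gamma>. a\<^sub>\<gamma> \<gamma>\<close>.

  For the latter, expanding \<open>\<Prod>\<gamma>\<noteq>1. (x\<^sub>\<gamma> \<otimes> 1 - 1 \<otimes> \<gamma>\<inverse> x\<^sub>\<gamma>)\<close> as \<open>\<Sum>i. s\<^sub>i \<otimes> t\<^sub>i\<close> gives
  \<open>\<Sum>i. s\<^sub>i g(t\<^sub>i) = 0\<close> for \<open>g \<noteq> 1\<close>, while the value at \<open>g = 1\<close> is \<open>\<Prod>\<gamma>\<noteq>1. (x\<^sub>\<gamma> - \<gamma>\<inverse> x\<^sub>\<gamma>)\<close>. One choice of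
  the \<open>x\<^sub>\<gamma>\<close> yields the coefficients \<open>a\<^sub>\<gamma>\<close> with a common invariant denominator. Varying the choice
  clears it: an element \<open>\<gamma> \<noteq> 1\<close> of \<open>\<Gamma>\<close> has finite order and determinant \<open>1\<close>, so \<open>1 - \<gamma>\<close> has rank
  at least two and \<open>x\<^sub>\<gamma> - \<gamma>\<inverse> x\<^sub>\<gamma>\<close> runs through independent, hence coprime, linear forms.\<close>

text \<open>Otherwise \<open>$\<close> is ambiguous between vectors and power series.\<close>

no_notation fps_nth (infixl \<open>$\<close> 75)

section \<open>The linear action on the polynomial ring\<close>

lemma poly_mapping_sum_single: "(\<Sum>m\<in>Poly_Mapping.keys p. Poly_Mapping.single m (Poly_Mapping.lookup p m)) = p"
  for p :: "'a \<Rightarrow>\<^sub>0 'b::comm_monoid_add"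
  by (rule poly_mapping_eqI)
     (auto simp: lookup_sum lookup_single when_def in_keys_iff)

text \<open>Reduces additive statements to monomials. Zero needs no case of its own, being the
  monomial with coefficient 0.\<close>

lemma poly_mapping_single_add_induct:
  fixes p :: "'a \<Rightarrow>\<^sub>0 'b::comm_monoid_add"
  assumes single: "\<And>m c. P (Poly_Mapping.single m c)" and add: "\<And>p q. P p \<Longrightarrow> P q \<Longrightarrow> P (p + q)"
  shows "P p"
proof -
  have "P (\<Sum>m\<in>A. Poly_Mapping.single m (Poly_Mapping.lookup p m))" if "finite A" for A
    using that single[of undefined 0] by (induction A rule: finite_induct) (auto intro: single add)
  from this[of "Poly_Mapping.keys p"] show ?thesis by (simp add: poly_mapping_sum_single)
qed

lemma lookup_mult_single_add:
  "Poly_Mapping.lookup (p * Poly_Mapping.single a 1) (m + a) = Poly_Mapping.lookup p m"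
  for p :: "'a::cancel_comm_monoid_add \<Rightarrow>\<^sub>0 'b::comm_semiring_1"
  by (induction p rule: poly_mapping_single_add_induct)
     (auto simp: mult_single lookup_single when_def lookup_add distrib_right)

text \<open>The index type carries no order. Numbering the variables by an injection into the
  naturals embeds the ring multiplicatively into polynomials whose exponents are linearly ordered,
  where the leading terms of nonzero factors multiply to a nonzero term.\<close>

lemma poly_mapping_no_zero_div:
  fixes p q :: "('n::finite \<Rightarrow>\<^sub>0 nat) \<Rightarrow>\<^sub>0 'b::idom"
  assumes "p * q = 0"
  shows "p = 0 \<or> q = 0"
proof -
  obtain f :: "'n \<Rightarrow> nat" where f: "inj f"
    using finite_imp_inj_to_nat_seg[OF finite_class.finite_UNIV] by metis
  define E where "E m = (\<Sum>i\<in>UNIV. Poly_Mapping.single (f i) (Poly_Mapping.lookup m i))"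
    for m :: "'n \<Rightarrow>\<^sub>0 nat"
  define F where "F p = (\<Sum>m\<in>Poly_Mapping.keys p. Poly_Mapping.single (E m) (Poly_Mapping.lookup p m))"
    for p :: "('n \<Rightarrow>\<^sub>0 nat) \<Rightarrow>\<^sub>0 'b"
  have "Poly_Mapping.lookup (E m) (f i) = Poly_Mapping.lookup m i" for m i
    unfolding E_def by (simp add: lookup_sum lookup_single when_def inj_eq[OF f])
  then have inj_E: "E m = E m' \<longleftrightarrow> m = m'" for m m'
    by (metis poly_mapping_eqI)
  have E_add: "E (m + m') = E m + E m'" for m m'
    by (simp add: E_def lookup_add single_add sum.distrib)
  have F_superset: "F p = (\<Sum>m\<in>A. Poly_Mapping.single (E m) (Poly_Mapping.lookup p m))"
    if "finite A" "Poly_Mapping.keys p \<subseteq> A" for p A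
    unfolding F_def using that by (intro sum.mono_neutral_left) (auto simp: in_keys_iff)
  have F_add: "F (p + q) = F p + F q" for p q
    using F_superset[of "Poly_Mapping.keys p \<union> Poly_Mapping.keys q"] Poly_Mapping.keys_add[of p q]
    by (simp add: lookup_add single_add sum.distrib)
  have F_single: "F (Poly_Mapping.single m c) = Poly_Mapping.single (E m) c" for m c
    by (simp add: F_def)
  have F_mult: "F (p * q) = F p * F q" for p q
  proof (induction p rule: poly_mapping_single_add_induct)
    case (1 m c)
    show ?case
      by (induction q rule: poly_mapping_single_add_induct)
         (simp_all add: mult_single F_single F_add E_add distrib_left)
  qed (simp add: F_add distrib_right)
  have F_zero: "p = 0" if "F p = 0" for p
  proof (rule poly_mapping_eqI)
    fix m
    have "Poly_Mapping.lookup (F p) (E m) = Poly_Mapping.lookup p m"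
      unfolding F_def by (simp add: lookup_sum lookup_single when_def inj_E in_keys_iff)
    then show "Poly_Mapping.lookup p m = Poly_Mapping.lookup 0 m" using that by simp
  qed
  have "F p * F q = 0" using assms F_mult[of p q] by (simp add: F_def)
  then show ?thesis using F_zero by auto
qed

section \<open>Constants, linear forms and the action by substitution\<close>

lemma const_0 [simp]: "const 0 = 0" and const_1 [simp]: "const 1 = 1"
  and const_add: "const (a + b) = const a + const b"
  and const_mult: "const (a * b) = const a * const b"
  by (simp_all add: const_def single_add mult_single)

lemma const_sum: "const (sum f A) = (\<Sum>i\<in>A. const (f i))"
  by (induction A rule: infinite_finite_induct) (auto simp: const_add)

lemma const_diff: "const (a - b) = const a - const b"
  by (simp add: const_def single_diff)

text \<open>The inclusion of \<open>V\<close> into its symmetric algebra as the part of degree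
  one.\<close>

definition linear_form :: "complex^'n \<Rightarrow> 'n sym" where
  "linear_form v = (\<Sum>j\<in>UNIV. const (v $ j) * var j)"

lemma var_power: "var i ^ k = Poly_Mapping.single (Poly_Mapping.single i k) 1"
  by (induction k) (simp_all add: var_def mult_single single_add[symmetric])

lemma single_eq_const_prod_var:
  fixes m :: "'n::finite \<Rightarrow>\<^sub>0 nat"
  shows "Poly_Mapping.single m c = const c * (\<Prod>i\<in>UNIV. var i ^ Poly_Mapping.lookup m i)"
proof -
  have "(\<Prod>i\<in>A. var i ^ Poly_Mapping.lookup m i)
      = Poly_Mapping.single (\<Sum>i\<in>A. Poly_Mapping.single i (Poly_Mapping.lookup m i)) 1" for A
    by (induction A rule: infinite_finite_induct) (auto simp: var_power mult_single)
  moreover have "(\<Sum>i\<in>UNIV. Poly_Mapping.single i (Poly_Mapping.lookup m i)) = m"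
    by (rule poly_mapping_eqI) (simp add: lookup_sum lookup_single when_def)
  ultimately show ?thesis by (simp add: const_def mult_single)
qed

lemma sym_act_single:
  "sym_act A (Poly_Mapping.single m c)
    = const c * (\<Prod>i\<in>UNIV. linear_form (column i A) ^ Poly_Mapping.lookup m i)"
  by (simp add: sym_act_def linear_form_def column_def)

text \<open>Cancellation makes the support of a sum unpredictable. A common larger index set lets
  two polynomials be added termwise.\<close>

lemma sym_act_superset:
  assumes "finite K" "Poly_Mapping.keys p \<subseteq> K"
  shows "sym_act A p = (\<Sum>m\<in>K. sym_act A (Poly_Mapping.single m (Poly_Mapping.lookup p m)))"
proof -
  have "sym_act A p = (\<Sum>m\<in>Poly_Mapping.keys p. sym_act A (Poly_Mapping.single m (Poly_Mapping.lookup p m)))"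
    unfolding sym_act_single by (simp add: sym_act_def linear_form_def column_def)
  also have "\<dots> = (\<Sum>m\<in>K. sym_act A (Poly_Mapping.single m (Poly_Mapping.lookup p m)))"
    using assms by (intro sum.mono_neutral_left) (auto simp: in_keys_iff sym_act_def)
  finally show ?thesis .
qed

lemma sym_act_add: "sym_act A (p + q) = sym_act A p + sym_act A q"
  using sym_act_superset[of "Poly_Mapping.keys p \<union> Poly_Mapping.keys q" _ A] Poly_Mapping.keys_add[of p q]
  by (simp add: sym_act_single lookup_add const_add distrib_right sum.distrib)

lemma sym_act_mult: "sym_act A (p * q) = sym_act A p * sym_act A q"
proof (induction p rule: poly_mapping_single_add_induct)
  case (1 m c)
  show ?case
  proof (induction q rule: poly_mapping_single_add_induct)
    case (1 m' c')
    show ?case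
      by (simp add: mult_single sym_act_single const_mult lookup_add power_add prod.distrib mult_ac)
  qed (simp add: sym_act_add distrib_left)
qed (simp add: sym_act_add distrib_right)

lemma sym_act_const [simp]: "sym_act A (const c) = const c"
  by (simp add: const_def sym_act_single)

lemma sym_act_1 [simp]: "sym_act A 1 = 1"
  using sym_act_const[of A 1] by simp

lemma sym_act_sum: "sym_act A (sum f I) = (\<Sum>i\<in>I. sym_act A (f i))"
  using sym_act_const[of A 0]
  by (induction I rule: infinite_finite_induct) (auto simp: sym_act_add)

lemma sym_act_power: "sym_act A (p ^ k) = sym_act A p ^ k"
  by (induction k) (auto simp: sym_act_mult)

lemma sym_act_prod: "sym_act A (prod f I) = (\<Prod>i\<in>I. sym_act A (f i))"
  by (induction I rule: infinite_finite_induct) (auto simp: sym_act_mult)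

lemma sym_act_var: "sym_act A (var i) = linear_form (column i A)"
proof -
  have "(\<Prod>j\<in>UNIV. linear_form (column j A) ^ Poly_Mapping.lookup (Poly_Mapping.single i 1) j)
      = (\<Prod>j\<in>UNIV. if j = i then linear_form (column j A) else 1)"
    by (intro prod.cong refl) (auto simp: lookup_single when_def)
  then show ?thesis by (simp add: var_def sym_act_single)
qed

lemma sym_act_linear_form: "sym_act A (linear_form v) = linear_form (A *v v)"
proof -
  have "sym_act A (linear_form v) = (\<Sum>j\<in>UNIV. \<Sum>k\<in>UNIV. const (A $ k $ j * v $ j) * var k)"
    by (simp add: linear_form_def sym_act_sum sym_act_mult sym_act_var column_def sum_distrib_left
        const_mult mult_ac)
  also have "\<dots> = (\<Sum>k\<in>UNIV. \<Sum>j\<in>UNIV. const (A $ k $ j * v $ j) * var k)"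
    by (rule sum.swap)
  also have "\<dots> = linear_form (A *v v)"
    by (simp add: linear_form_def matrix_vector_mult_def const_sum sum_distrib_right)
  finally show ?thesis .
qed

lemma sym_act_compose: "sym_act (A ** B) p = sym_act A (sym_act B p)"
proof (induction p rule: poly_mapping_single_add_induct)
  case (1 m c)
  have "column i (A ** B) = A *v column i B" for i
    by (simp add: column_def matrix_matrix_mult_def matrix_vector_mult_def)
  then show ?case
    by (simp add: sym_act_single sym_act_mult sym_act_prod sym_act_power sym_act_linear_form)
qed (simp add: sym_act_add)

lemma linear_form_axis: "linear_form (axis i 1) = var i"
  by (simp add: linear_form_def axis_def if_distrib if_distribR cong: if_cong)

lemma sym_act_mat_1: "sym_act (mat 1) p = p"
proof (induction p rule: poly_mapping_single_add_induct)
  case (1 m c)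
  have "column i (mat 1) = axis i (1::complex)" for i :: 'a
    by (auto simp: column_def mat_def axis_def vec_eq_iff)
  then have "sym_act (mat 1) (Poly_Mapping.single m c)
      = const c * (\<Prod>i\<in>UNIV. var i ^ Poly_Mapping.lookup m i)"
    by (simp add: sym_act_single linear_form_axis)
  then show ?case by (simp only: single_eq_const_prod_var)
qed (simp add: sym_act_add)

lemma linear_form_diff: "linear_form (v - w) = linear_form v - linear_form w"
  by (simp add: linear_form_def const_diff left_diff_distrib sum_subtractf)

lemma linear_form_eq_0_iff: "linear_form v = 0 \<longleftrightarrow> v = 0"
proof
  assume "linear_form v = 0"
  moreover have "Poly_Mapping.lookup (linear_form v) (Poly_Mapping.single i 1) = v $ i" for i
  proof -
    have "Poly_Mapping.single j 1 = Poly_Mapping.single i (1::nat) \<longleftrightarrow> j = i" for j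
      by (metis lookup_single_eq lookup_single_not_eq one_neq_zero)
    then show ?thesis
      by (simp add: linear_form_def const_def var_def mult_single lookup_sum lookup_single when_def)
  qed
  ultimately show "v = 0" by (metis lookup_zero vec_eq_iff zero_index)
qed (simp add: linear_form_def)

section \<open>Coprimality of independent linear forms\<close>

text \<open>Every monomial of \<open>q * var i\<close> contains the variable \<open>i\<close>.
  Multiplication by \<open>var j\<close> shifts exponents without touching the one at
  \<open>i\<close>, so every monomial of \<open>p\<close> contains that variable too.\<close>

lemma var_dvd_of_mult_var_eq:
  assumes eq: "p * var j = q * var i" and "i \<noteq> j"
  shows "var i dvd p"
proof -
  have zero: "Poly_Mapping.lookup (q * var i) m = 0" if "Poly_Mapping.lookup m i = 0" for m q
  proof (induction q rule: poly_mapping_single_add_induct)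
    case (1 m' c)
    have "m' + Poly_Mapping.single i 1 \<noteq> m" using that by (auto simp: lookup_add)
    then show ?case by (simp add: var_def mult_single lookup_single)
  qed (simp add: lookup_add distrib_right)
  have "var i dvd Poly_Mapping.single m (Poly_Mapping.lookup p m)"
    if m: "m \<in> Poly_Mapping.keys p" for m
  proof -
    have "Poly_Mapping.lookup m i \<noteq> 0"
    proof
      assume "Poly_Mapping.lookup m i = 0"
      then have "Poly_Mapping.lookup (m + Poly_Mapping.single j 1) i = 0"
        using \<open>i \<noteq> j\<close> by (simp add: lookup_add lookup_single)
      then have "Poly_Mapping.lookup (p * var j) (m + Poly_Mapping.single j 1) = 0"
        unfolding eq by (rule zero)
      then show False using m by (simp add: var_def lookup_mult_single_add in_keys_iff)
    qed
    \<comment> \<open>Subtraction of exponents is truncated; it is undone here because the exponent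
      at \<open>i\<close> is positive.\<close>
    then have "m - Poly_Mapping.single i 1 + Poly_Mapping.single i 1 = m"
      by (intro poly_mapping_eqI) (auto simp: lookup_add lookup_minus lookup_single when_def)
    then have "Poly_Mapping.single m (Poly_Mapping.lookup p m)
        = var i * Poly_Mapping.single (m - Poly_Mapping.single i 1) (Poly_Mapping.lookup p m)"
      by (simp add: var_def mult_single add.commute)
    then show ?thesis by simp
  qed
  then show ?thesis
    by (subst poly_mapping_sum_single[symmetric]) (rule dvd_sum)
qed

text \<open>A nonzero minor makes \<open>v\<close> and \<open>w\<close> independent, so a linear
  change of variables turns their forms into two distinct variables, where
  \<open>var_dvd_of_mult_var_eq\<close> applies.\<close>

lemma linear_form_dvd_of_mult_linear_form_eq:
  fixes v w :: "complex^'n"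
  assumes minor: "v $ i * w $ j \<noteq> v $ j * w $ i"
    and eq: "p * linear_form w = q * linear_form v"
  shows "linear_form v dvd p"
proof -
  have "i \<noteq> j" using minor by auto
  \<comment> \<open>The identity matrix with columns \<open>i\<close> and \<open>j\<close> replaced
    by \<open>v\<close> and \<open>w\<close>.\<close>
  define B :: "complex^'n^'n" where
    "B = (\<chi> r c. if c = i then v $ r else if c = j then w $ r else if r = c then 1 else 0)"
  have B_mult: "(B *v x) $ r = v $ r * x $ i + w $ r * x $ j + (if r = i \<or> r = j then 0 else x $ r)" for x r
  proof -
    have "(B *v x) $ r = (\<Sum>c\<in>UNIV. B $ r $ c * x $ c)"
      by (simp add: matrix_vector_mult_def)
    also have "\<dots> = (\<Sum>c\<in>UNIV. (if c = i then v $ r * x $ i else 0)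
        + (if c = j then w $ r * x $ j else 0)
        + (if c = r then (if r = i \<or> r = j then 0 else x $ r) else 0))"
      using \<open>i \<noteq> j\<close> by (intro sum.cong refl) (auto simp: B_def)
    finally show ?thesis by (simp add: sum.distrib)
  qed
  have "x = 0" if "B *v x = 0" for x
  proof -
    have *: "v $ r * x $ i + w $ r * x $ j + (if r = i \<or> r = j then 0 else x $ r) = 0" for r
      using B_mult[of x r] that by simp
    have e: "v $ i * x $ i + w $ i * x $ j = 0" "v $ j * x $ i + w $ j * x $ j = 0"
      using *[of i] *[of j] by auto
    have "(v $ i * w $ j - v $ j * w $ i) * x $ i
        = w $ j * (v $ i * x $ i + w $ i * x $ j) - w $ i * (v $ j * x $ i + w $ j * x $ j)"
      "(v $ i * w $ j - v $ j * w $ i) * x $ j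
        = v $ i * (v $ j * x $ i + w $ j * x $ j) - v $ j * (v $ i * x $ i + w $ i * x $ j)"
      by (simp_all add: algebra_simps)
    then have "x $ i = 0" "x $ j = 0" using minor e by auto
    then have "x $ r = 0" for r using *[of r] by (auto split: if_splits)
    then show ?thesis by (simp add: vec_eq_iff)
  qed
  then obtain B' where B': "B' ** B = mat 1" "B ** B' = mat 1"
    using matrix_left_invertible_ker[of B] matrix_left_right_inverse by metis
  have "B *v axis i 1 = v" "B *v axis j 1 = w"
    using \<open>i \<noteq> j\<close> by (auto simp: vec_eq_iff B_mult axis_def)
  then have B_var: "sym_act B (var i) = linear_form v" "sym_act B (var j) = linear_form w"
    unfolding linear_form_axis[symmetric] sym_act_linear_form by simp_all
  have B'_B: "sym_act B' (sym_act B r) = r" and B_B': "sym_act B (sym_act B' r) = r" for r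
    unfolding sym_act_compose[symmetric] B' by (rule sym_act_mat_1)+
  have "sym_act B' (p * sym_act B (var j)) = sym_act B' (q * sym_act B (var i))"
    using eq by (simp add: B_var)
  then have "sym_act B' p * var j = sym_act B' q * var i" by (simp add: sym_act_mult B'_B)
  then have "var i dvd sym_act B' p" using \<open>i \<noteq> j\<close> by (rule var_dvd_of_mult_var_eq)
  then obtain r where "sym_act B' p = var i * r" by (elim dvdE)
  then have "p = linear_form v * sym_act B r" by (metis B_B' B_var(1) sym_act_mult)
  then show ?thesis by simp
qed

section \<open>Finite groups acting on a domain\<close>

locale finite_ring_action = group G for G (structure) +
  fixes act :: "'a \<Rightarrow> 's \<Rightarrow> 's::comm_ring_1"
  assumes finite_carrier: "finite (carrier G)"
    and act_add: "g \<in> carrier G \<Longrightarrow> act g (x + y) = act g x + act g y"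
    and act_mult: "g \<in> carrier G \<Longrightarrow> act g (x * y) = act g x * act g y"
    and act_unit: "g \<in> carrier G \<Longrightarrow> act g 1 = 1"
    and act_comp: "g \<in> carrier G \<Longrightarrow> h \<in> carrier G \<Longrightarrow> act (g \<otimes> h) x = act g (act h x)"
    and act_id: "act \<one> x = x"
begin

lemma act_zero: "g \<in> carrier G \<Longrightarrow> act g 0 = 0"
  using act_add[of g 0 0] by simp

lemma act_uminus: "g \<in> carrier G \<Longrightarrow> act g (- x) = - act g x"
  using act_add[of g x "- x"] by (simp add: act_zero eq_neg_iff_add_eq_0 add.commute)

lemma act_sum: "g \<in> carrier G \<Longrightarrow> act g (sum f A) = (\<Sum>i\<in>A. act g (f i))"
  by (induction A rule: infinite_finite_induct) (auto simp: act_zero act_add)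

lemma act_prod: "g \<in> carrier G \<Longrightarrow> act g (prod f A) = (\<Prod>i\<in>A. act g (f i))"
  by (induction A rule: infinite_finite_induct) (auto simp: act_unit act_mult)

lemma act_inv_act: "g \<in> carrier G \<Longrightarrow> act (inv g) (act g x) = x"
  by (metis act_comp act_id inv_closed l_inv)

lemma act_act_inv: "g \<in> carrier G \<Longrightarrow> act g (act (inv g) x) = x"
  by (metis act_comp act_id inv_closed r_inv)

lemma bij_mult_left: "h \<in> carrier G \<Longrightarrow> bij_betw (\<lambda>g. h \<otimes> g) (carrier G) (carrier G)"
  by (rule bij_betw_byWitness[where f' = "\<lambda>g. inv h \<otimes> g"]) (auto simp: m_assoc[symmetric])

text \<open>Left multiplication by \<open>h\<close> permutes the factors. This supplies the
  invariant denominator.\<close>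

lemma act_norm:
  assumes "h \<in> carrier G"
  shows "act h (\<Prod>g\<in>carrier G. act g x) = (\<Prod>g\<in>carrier G. act g x)"
proof -
  have "act h (\<Prod>g\<in>carrier G. act g x) = (\<Prod>g\<in>carrier G. act (h \<otimes> g) x)"
    using assms by (auto simp: act_prod act_comp intro!: prod.cong)
  also have "\<dots> = (\<Prod>g\<in>carrier G. act g x)"
    using bij_mult_left[OF assms] by (rule prod.reindex_bij_betw)
  finally show ?thesis .
qed

text \<open>Traces are the invariants past which a linear map over the invariant ring will be
  pulled.\<close>

lemma act_trace:
  assumes "h \<in> carrier G"
  shows "act h (\<Sum>g\<in>carrier G. act g x) = (\<Sum>g\<in>carrier G. act g x)"
proof -
  have "act h (\<Sum>g\<in>carrier G. act g x) = (\<Sum>g\<in>carrier G. act (h \<otimes> g) x)"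
    using assms by (auto simp: act_sum act_comp intro!: sum.cong)
  also have "\<dots> = (\<Sum>g\<in>carrier G. act g x)"
    using bij_mult_left[OF assms] by (rule sum.reindex_bij_betw)
  finally show ?thesis .
qed

section \<open>Separating group elements by a tensor\<close>

text \<open>The value at the identity of the tensor expanded in \<open>galois_system\<close>; each
  factor measures how far a group element moves its chosen witness.\<close>

definition separator :: "('a \<Rightarrow> 's) \<Rightarrow> 's" where
  "separator x = (\<Prod>\<gamma>\<in>carrier G - {\<one>}. x \<gamma> - act (inv \<gamma>) (x \<gamma>))"

text \<open>Applying \<open>1 \<otimes> g\<close> to \<open>\<Prod>\<gamma>. (x \<gamma> \<otimes> 1 - 1 \<otimes> \<gamma>\<inverse> (x \<gamma>))\<close> and multiplying kills the factor
  with \<open>\<gamma> = g\<close>.\<close>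

lemma galois_system:
  obtains I :: "'a set set" and s t where
    "\<And>g. g \<in> carrier G \<Longrightarrow> (\<Sum>i\<in>I. s i * act g (t i)) = (if g = \<one> then separator x else 0)"
proof -
  let ?A = "carrier G - {\<one>}"
  \<comment> \<open>A term of the expanded product is given by the set \<open>B\<close> of factors
    contributing \<open>x \<gamma>\<close>; the factors outside \<open>B\<close> contribute their
    second summand. Hence the index type of sets.\<close>
  let ?t = "\<lambda>B. \<Prod>\<gamma>\<in>?A - B. - act (inv \<gamma>) (x \<gamma>)"
  have fin: "finite ?A" using finite_carrier by simp
  have *: "(\<Sum>B\<in>Pow ?A. prod x B * act g (?t B)) = (if g = \<one> then separator x else 0)"
    if g: "g \<in> carrier G" for g
  proof -
    have "(\<Sum>B\<in>Pow ?A. prod x B * act g (?t B))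
        = (\<Sum>B\<in>Pow ?A. prod x B * (\<Prod>\<gamma>\<in>?A - B. - act g (act (inv \<gamma>) (x \<gamma>))))"
      using g by (simp add: act_prod act_uminus)
    also have "\<dots> = (\<Prod>\<gamma>\<in>?A. x \<gamma> + - act g (act (inv \<gamma>) (x \<gamma>)))"
      by (rule prod_add[OF fin, symmetric])
    also have "\<dots> = (if g = \<one> then separator x else 0)"
    proof (cases "g = \<one>")
      case False
      then show ?thesis using g fin by (auto intro!: prod_zero bexI[of _ g] simp: act_act_inv)
    qed (simp add: act_id separator_def)
    finally show ?thesis .
  qed
  show ?thesis by (rule that[OF *])
qed

text \<open>Pulling \<tau> out of the sum over \<open>I\<close> leaves the system evaluated at
  \<open>inv \<tau> \<otimes> g\<close>, which vanishes unless \<open>g = \<tau>\<close>. The system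
  thus isolates one coefficient of the operator with coefficients \<open>d\<close>.\<close>

lemma galois_system_translate:
  assumes gal: "\<And>g. g \<in> carrier G \<Longrightarrow> (\<Sum>i\<in>I. s i * act g (t i)) = (if g = \<one> then u else 0)"
    and "\<tau> \<in> carrier G"
  shows "(\<Sum>i\<in>I. act \<tau> (s i) * (\<Sum>g\<in>carrier G. d g * act g (t i))) = d \<tau> * act \<tau> u"
proof -
  have "(\<Sum>i\<in>I. act \<tau> (s i) * (\<Sum>g\<in>carrier G. d g * act g (t i)))
      = (\<Sum>g\<in>carrier G. d g * (\<Sum>i\<in>I. act \<tau> (s i) * act g (t i)))"
    by (simp add: sum_distrib_left mult.left_commute) (rule sum.swap)
  also have "\<dots> = (\<Sum>g\<in>carrier G. if g = \<tau> then d g * act \<tau> u else 0)"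
  proof (rule sum.cong[OF refl])
    fix g assume g: "g \<in> carrier G"
    have "(\<Sum>i\<in>I. act \<tau> (s i) * act g (t i)) = act \<tau> (\<Sum>i\<in>I. s i * act (inv \<tau> \<otimes> g) (t i))"
      using assms(2) g by (simp add: act_sum act_mult act_comp act_act_inv)
    also have "\<dots> = act \<tau> (if inv \<tau> \<otimes> g = \<one> then u else 0)"
      using gal[of "inv \<tau> \<otimes> g"] g assms(2) by simp
    also have "inv \<tau> \<otimes> g = \<one> \<longleftrightarrow> g = \<tau>"
      using g assms(2) by (metis inv_closed inv_equality inv_inv l_inv)
    finally show "d g * (\<Sum>i\<in>I. act \<tau> (s i) * act g (t i)) = (if g = \<tau> then d g * act \<tau> u else 0)"
      using assms(2) by (auto simp: act_zero)
  qed
  also have "\<dots> = d \<tau> * act \<tau> u"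
    using assms(2) finite_carrier by (simp add: sum.delta)
  finally show ?thesis .
qed

lemma act_nonzero: "g \<in> carrier G \<Longrightarrow> x \<noteq> 0 \<Longrightarrow> act g x \<noteq> 0"
  by (metis act_inv_act act_zero inv_closed)

end

lemma prod_nonzero_no_zero_div:
  fixes f :: "'i \<Rightarrow> 's::comm_ring_1"
  assumes "\<And>a b :: 's. a * b = 0 \<Longrightarrow> a = 0 \<or> b = 0" "\<And>i. i \<in> A \<Longrightarrow> f i \<noteq> 0"
  shows "prod f A \<noteq> 0"
  using assms(2) by (induction A rule: infinite_finite_induct) (use assms(1) in auto)

text \<open>Absence of zero divisors is a locale assumption instead of a type class, so that
  \<open>poly_mapping_no_zero_div\<close> can discharge it for an unordered index type.\<close>

locale finite_domain_action = finite_ring_action G act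
  for G (structure) and act :: "'a \<Rightarrow> 's \<Rightarrow> 's::comm_ring_1" +
  assumes no_zero_div: "(a::'s) * b = 0 \<Longrightarrow> a = 0 \<or> b = 0"
begin

lemma cancel_left: "(c::'s) * a = c * b \<Longrightarrow> c \<noteq> 0 \<Longrightarrow> a = b"
  using no_zero_div[of c "a - b"] by (simp add: algebra_simps)

lemma separator_nonzero:
  assumes "\<And>\<gamma>. \<gamma> \<in> carrier G - {\<one>} \<Longrightarrow> x \<gamma> - act (inv \<gamma>) (x \<gamma>) \<noteq> 0"
  shows "separator x \<noteq> 0"
  unfolding separator_def by (rule prod_nonzero_no_zero_div[OF no_zero_div]) (use assms in auto)

text \<open>Faithfulness provides a nonzero separator, and the translated Galois system shows that
  \<open>d \<tau>\<close> times its image under \<tau> is zero.\<close>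

theorem act_independent:
  assumes faithful: "\<And>g. g \<in> carrier G \<Longrightarrow> g \<noteq> \<one> \<Longrightarrow> \<exists>x. act g x \<noteq> x"
    and zero: "\<And>s. (\<Sum>g\<in>carrier G. d g * act g s) = 0" and "\<tau> \<in> carrier G"
  shows "d \<tau> = 0"
proof -
  have "\<exists>y. y - act (inv \<gamma>) y \<noteq> 0" if "\<gamma> \<in> carrier G - {\<one>}" for \<gamma>
    using faithful[of "inv \<gamma>"] that by force
  then obtain x where x: "\<And>\<gamma>. \<gamma> \<in> carrier G - {\<one>} \<Longrightarrow> x \<gamma> - act (inv \<gamma>) (x \<gamma>) \<noteq> 0"
    by metis
  obtain I :: "'a set set" and s t where gal:
    "\<And>g. g \<in> carrier G \<Longrightarrow> (\<Sum>i\<in>I. s i * act g (t i)) = (if g = \<one> then separator x else 0)"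
    using galois_system[of x] by metis
  have "d \<tau> * act \<tau> (separator x) = 0"
    using galois_system_translate[OF gal \<open>\<tau> \<in> carrier G\<close>, of d] by (simp add: zero)
  then show ?thesis
    using no_zero_div act_nonzero[OF \<open>\<tau> \<in> carrier G\<close> separator_nonzero[OF x]] by blast
qed

text \<open>The hypothesis says that no \<open>\<gamma> \<noteq> \<one>\<close> acts trivially modulo a prime of height one.\<close>

theorem invariant_linear_map_eq_sum_act:
  assumes codim: "\<And>\<gamma>. \<gamma> \<in> carrier G \<Longrightarrow> \<gamma> \<noteq> \<one> \<Longrightarrow> \<exists>x y. x - act \<gamma> x \<noteq> 0 \<and>
      (\<forall>p q. p * (y - act \<gamma> y) = q * (x - act \<gamma> x) \<longrightarrow> x - act \<gamma> x dvd p)"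
    and add: "\<And>x y. \<phi> (x + y) = \<phi> x + \<phi> y"
    and lin: "\<And>x r. (\<And>g. g \<in> carrier G \<Longrightarrow> act g r = r) \<Longrightarrow> \<phi> (x * r) = \<phi> x * r"
  obtains a where "\<And>s. \<phi> s = (\<Sum>g\<in>carrier G. a g * act g s)"
proof -
  have \<phi>0: "\<phi> 0 = 0" using add[of 0 0] by simp
  have \<phi>_sum: "\<phi> (sum f A) = (\<Sum>i\<in>A. \<phi> (f i))" for f :: "'a set \<Rightarrow> 's" and A
    by (induction A rule: infinite_finite_induct) (auto simp: \<phi>0 add)
  \<comment> \<open>Restated for inverses, the form in which group elements enter the
    separator.\<close>
  have codim': "\<exists>x y. x - act (inv \<gamma>) x \<noteq> 0 \<and>
      (\<forall>p q. p * (y - act (inv \<gamma>) y) = q * (x - act (inv \<gamma>) x) \<longrightarrow> x - act (inv \<gamma>) x dvd p)"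
    if "\<gamma> \<in> carrier G - {\<one>}" for \<gamma>
    using codim[of "inv \<gamma>"] that by force
  obtain x where x: "\<And>\<gamma>. \<gamma> \<in> carrier G - {\<one>} \<Longrightarrow> x \<gamma> - act (inv \<gamma>) (x \<gamma>) \<noteq> 0"
    using codim' by metis
  define v where "v = separator x"
  \<comment> \<open>The norm \<open>u\<close> of \<open>v\<close> is invariant, and \<open>w\<close>
    is the cofactor with \<open>u = v * w\<close>.\<close>
  define w where "w = (\<Prod>g\<in>carrier G - {\<one>}. act g v)"
  define u where "u = (\<Prod>g\<in>carrier G. act g v)"
  have u: "u = v * w"
    unfolding u_def w_def using prod.remove[OF finite_carrier, of \<one> "\<lambda>g. act g v"]
    by (simp add: act_id)
  have u0: "u \<noteq> 0"
    unfolding u_def v_def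
    by (intro prod_nonzero_no_zero_div[OF no_zero_div] act_nonzero separator_nonzero x)
  have u_inv: "act g u = u" if "g \<in> carrier G" for g
    unfolding u_def by (rule act_norm[OF that])
  obtain I :: "'a set set" and s t where gal:
    "\<And>g. g \<in> carrier G \<Longrightarrow> (\<Sum>i\<in>I. s i * act g (t i)) = (if g = \<one> then v else 0)"
    using galois_system[of x] unfolding v_def by metis
  define b where "b g = (\<Sum>i\<in>I. \<phi> (s i * w) * act g (t i))" for g
  have u_\<phi>: "\<phi> y * u = (\<Sum>g\<in>carrier G. b g * act g y)" for y
  proof -
    \<comment> \<open>Only \<open>g = \<one>\<close> contributes. Replacing the delta by the Galois
      sum rewrites \<open>y * u\<close> as a combination of the \<open>s i * w\<close> with traces
      as coefficients.\<close>
    have "y * u = (\<Sum>g\<in>carrier G. (if g = \<one> then v else 0) * w * act g y)"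
      using finite_carrier by (simp add: if_distrib if_distribR sum.delta act_id u algebra_simps cong: if_cong)
    also have "\<dots> = (\<Sum>g\<in>carrier G. (\<Sum>i\<in>I. s i * act g (t i)) * w * act g y)"
      by (intro sum.cong refl) (simp add: gal)
    also have "\<dots> = (\<Sum>i\<in>I. s i * w * (\<Sum>g\<in>carrier G. act g (t i * y)))"
      by (simp add: sum_distrib_left sum_distrib_right act_mult algebra_simps)
         (rule sum.swap)
    finally have "\<phi> (y * u) = \<phi> (\<Sum>i\<in>I. s i * w * (\<Sum>g\<in>carrier G. act g (t i * y)))" by simp
    also have "\<dots> = (\<Sum>i\<in>I. \<phi> (s i * w) * (\<Sum>g\<in>carrier G. act g (t i * y)))"
      by (simp add: \<phi>_sum lin act_trace)
    also have "\<dots> = (\<Sum>g\<in>carrier G. b g * act g y)"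
      unfolding b_def by (simp add: sum_distrib_left sum_distrib_right act_mult algebra_simps)
         (rule sum.swap)
    finally show ?thesis by (simp add: lin u_inv)
  qed
  \<comment> \<open>For an arbitrary choice \<open>y\<close>, a second Galois system isolates
    \<open>b \<tau>\<close> times the image of \<open>separator y\<close>, while
    \<open>u_\<phi>\<close> exhibits the same sum as a multiple of \<open>u\<close>.\<close>
  have dvd_sep: "u dvd act (inv \<tau>) (b \<tau>) * separator y" if \<tau>: "\<tau> \<in> carrier G" for \<tau> y
  proof -
    obtain J :: "'a set set" and s' t' where gal':
      "\<And>g. g \<in> carrier G \<Longrightarrow> (\<Sum>i\<in>J. s' i * act g (t' i)) = (if g = \<one> then separator y else 0)"
      using galois_system[of y] by metis
    have "b \<tau> * act \<tau> (separator y)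
        = (\<Sum>i\<in>J. act \<tau> (s' i) * (\<Sum>g\<in>carrier G. b g * act g (t' i)))"
      by (rule galois_system_translate[OF gal' \<tau>, symmetric])
    also have "\<dots> = (\<Sum>i\<in>J. act \<tau> (s' i) * \<phi> (t' i)) * u"
      by (simp only: u_\<phi>[symmetric] sum_distrib_right mult.assoc)
    finally have "act (inv \<tau>) (b \<tau> * act \<tau> (separator y))
        = act (inv \<tau>) ((\<Sum>i\<in>J. act \<tau> (s' i) * \<phi> (t' i)) * u)" by simp
    then have "act (inv \<tau>) (b \<tau>) * separator y
        = act (inv \<tau>) (\<Sum>i\<in>J. act \<tau> (s' i) * \<phi> (t' i)) * u"
      using \<tau> by (simp add: act_mult act_inv_act u_inv)
    then show ?thesis by simp
  qed
  \<comment> \<open>The separator factors are stripped one at a time: the witness of a single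
    \<gamma> is set to \<open>z\<close> and then to \<open>z'\<close>, whose differences are
    coprime, while the others stay fixed.\<close>
  have remove: "u dvd c"
    if "finite A" "A \<subseteq> carrier G - {\<one>}"
      "\<And>y. u dvd c * (\<Prod>\<gamma>\<in>A. y \<gamma> - act (inv \<gamma>) (y \<gamma>))" for c A
    using that
  proof (induction A rule: finite_induct)
    case (insert \<gamma> A)
    from insert.prems(1) have \<gamma>: "\<gamma> \<in> carrier G - {\<one>}" by simp
    let ?d = "\<lambda>z. z - act (inv \<gamma>) z"
    from codim'[OF \<gamma>] obtain z z' where z: "?d z \<noteq> 0"
      and zz: "\<And>p q. p * ?d z' = q * ?d z \<Longrightarrow> ?d z dvd p" by metis
    show ?case
    proof (rule insert.IH)
      fix y
      let ?m = "\<Prod>\<gamma>\<in>A. y \<gamma> - act (inv \<gamma>) (y \<gamma>)"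
      have upd: "u dvd c * ?m * ?d w" for w
      proof -
        have "(\<Prod>\<gamma>'\<in>A. (y(\<gamma> := w)) \<gamma>' - act (inv \<gamma>') ((y(\<gamma> := w)) \<gamma>')) = ?m"
          using insert.hyps by (intro prod.cong) auto
        then show ?thesis
          using insert.prems(2)[of "y(\<gamma> := w)"] insert.hyps by (simp add: mult_ac)
      qed
      obtain p q where p: "c * ?m * ?d z = u * p" and q: "c * ?m * ?d z' = u * q"
        using upd[of z] upd[of z'] by (auto elim!: dvdE)
      \<comment> \<open>Both sides equal \<open>c * ?m * ?d z * ?d z'\<close>; cancelling
        \<open>u\<close> gives the premise of \<open>zz\<close>.\<close>
      have "u * (p * ?d z') = u * (q * ?d z)"
      proof -
        have "u * (p * ?d z') = (u * p) * ?d z'" by (rule mult.assoc[symmetric])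
        also have "\<dots> = (u * q) * ?d z" unfolding p[symmetric] q[symmetric] by (simp only: mult_ac)
        finally show ?thesis by (simp only: mult.assoc)
      qed
      then have "?d z dvd p" using zz cancel_left u0 by blast
      then obtain r where "p = ?d z * r" by (elim dvdE)
      with p have "?d z * (c * ?m) = ?d z * (u * r)" by (simp only: mult_ac)
      then have "c * ?m = u * r" using z cancel_left by blast
      then show "u dvd c * ?m" by simp
    qed (use insert.prems in auto)
  qed simp
  have "\<exists>a. b \<tau> = u * a" if \<tau>: "\<tau> \<in> carrier G" for \<tau>
  proof -
    have "u dvd act (inv \<tau>) (b \<tau>)"
      by (rule remove[of "carrier G - {\<one>}"])
         (use finite_carrier dvd_sep[OF \<tau>] in \<open>auto simp: separator_def\<close>)
    then obtain a where "act (inv \<tau>) (b \<tau>) = u * a" by (elim dvdE)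
    then have "b \<tau> = u * act \<tau> a"
      using act_act_inv[OF \<tau>, of "b \<tau>"] \<tau> by (simp add: act_mult u_inv)
    then show ?thesis by blast
  qed
  then obtain a where a: "\<And>\<tau>. \<tau> \<in> carrier G \<Longrightarrow> b \<tau> = u * a \<tau>" by metis
  show ?thesis
  proof (rule that)
    fix y
    have "u * \<phi> y = u * (\<Sum>g\<in>carrier G. a g * act g y)"
      using u_\<phi>[of y] a by (simp add: sum_distrib_left mult_ac)
    then show "\<phi> y = (\<Sum>g\<in>carrier G. a g * act g y)" using cancel_left u0 by blast
  qed
qed

end

section \<open>Endomorphisms of skew group rings\<close>

lemma ring_of_type_algebra_simps [simp]:
  "carrier ring_of_type_algebra = UNIV"
  "x \<otimes>\<^bsub>ring_of_type_algebra\<^esub> y = x * y"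
  "x \<oplus>\<^bsub>ring_of_type_algebra\<^esub> y = x + y"
  "\<one>\<^bsub>ring_of_type_algebra\<^esub> = 1"
  "\<zero>\<^bsub>ring_of_type_algebra\<^esub> = 0"
  by (simp_all add: ring_of_type_algebra_def)

lemma finsum_ring_of_type_algebra:
  fixes f :: "'i \<Rightarrow> 's::comm_ring_1"
  assumes "finite A"
  shows "finsum ring_of_type_algebra f A = sum f A"
proof -
  interpret ring "ring_of_type_algebra :: 's ring" by (rule ring_from_type_algebra)
  show ?thesis
    using assms by (induction A rule: finite_induct) (auto simp: finsum_insert)
qed

context finite_ring_action
begin

abbreviation (input) SG :: "('a \<Rightarrow> 's) ring" where
  "SG \<equiv> skew_group_ring ring_of_type_algebra G act"

lemma skew_group_ring_carrier: "carrier SG = carrier G \<rightarrow>\<^sub>E UNIV"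
  using finite_carrier by (auto simp: skew_group_ring_def)

lemma skew_group_ring_add: "f \<oplus>\<^bsub>SG\<^esub> f' = (\<lambda>k\<in>carrier G. f k + f' k)"
  by (simp add: skew_group_ring_def)

lemma skew_group_ring_one: "\<one>\<^bsub>SG\<^esub> = (\<lambda>k\<in>carrier G. if k = \<one> then 1 else 0)"
  by (auto simp: skew_group_ring_def fun_eq_iff)

lemma skew_group_ring_mult:
  "f \<otimes>\<^bsub>SG\<^esub> f' = (\<lambda>k\<in>carrier G. \<Sum>g\<in>carrier G. f g * act g (f' (inv g \<otimes> k)))"
proof -
  have "(\<Oplus>\<^bsub>ring_of_type_algebra\<^esub>g\<in>{g \<in> carrier G. f g \<noteq> 0}. f g * act g (f' (inv g \<otimes> k)))
      = (\<Sum>g\<in>carrier G. f g * act g (f' (inv g \<otimes> k)))" for k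
    using finite_carrier
    by (subst finsum_ring_of_type_algebra) (auto intro!: sum.mono_neutral_left)
  then show ?thesis by (simp add: skew_group_ring_def)
qed

end

text \<open>The map is constructed from the skew group ring to the endomorphism ring, opposite to
  the direction claimed. Its inverse respects the operations because every element of
  \<open>B\<close> is an image and \<open>A\<close> is closed.\<close>

lemma is_ring_iso_symI:
  assumes iso: "\<psi> \<in> ring_iso A B"
    and closed: "\<And>x y. x \<in> carrier A \<Longrightarrow> y \<in> carrier A \<Longrightarrow> x \<otimes>\<^bsub>A\<^esub> y \<in> carrier A \<and> x \<oplus>\<^bsub>A\<^esub> y \<in> carrier A"
    and one: "\<one>\<^bsub>A\<^esub> \<in> carrier A"
  shows "B \<simeq> A"
proof -
  let ?i = "inv_into (carrier A) \<psi>"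
  have bij: "bij_betw \<psi> (carrier A) (carrier B)"
    and hom: "\<psi> \<in> ring_hom A B" using iso by (auto simp: ring_iso_def)
  have i: "?i (\<psi> x) = x" if "x \<in> carrier A" for x
    using bij that by (simp add: bij_betw_inv_into_left)
  have surj: "\<exists>x\<in>carrier A. y = \<psi> x" if "y \<in> carrier B" for y
    using bij that by (auto simp: bij_betw_def)
  have "?i \<in> ring_iso B A"
  proof (rule ring_iso_memI)
    show "bij_betw ?i (carrier B) (carrier A)" using bij by (rule bij_betw_inv_into)
    then show "?i x \<in> carrier A" if "x \<in> carrier B" for x using that by (auto simp: bij_betw_def)
    show "?i (x \<otimes>\<^bsub>B\<^esub> y) = ?i x \<otimes>\<^bsub>A\<^esub> ?i y" "?i (x \<oplus>\<^bsub>B\<^esub> y) = ?i x \<oplus>\<^bsub>A\<^esub> ?i y"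
      if "x \<in> carrier B" "y \<in> carrier B" for x y
      using surj[OF that(1)] surj[OF that(2)] closed i
      by (auto simp: ring_hom_mult[OF hom, symmetric] ring_hom_add[OF hom, symmetric])
    show "?i \<one>\<^bsub>B\<^esub> = \<one>\<^bsub>A\<^esub>"
      using i[OF one] ring_hom_one[OF hom] by simp
  qed
  then show ?thesis by (auto simp: is_ring_iso_def)
qed

section \<open>Semidirect products acting on a ring\<close>

text \<open>A homomorphism \<pi> onto \<open>H\<close> that fixes \<open>H\<close> presents the
  group as the semidirect product of its kernel with \<open>H\<close>.\<close>

locale semidirect_ring_action = finite_ring_action G act
  for G (structure) and act :: "'a \<Rightarrow> 's \<Rightarrow> 's::comm_ring_1" +
  fixes H :: "'a set" and \<pi> :: "'a \<Rightarrow> 'a"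
  assumes subgroup_H: "subgroup H G"
    and retract_closed: "g \<in> carrier G \<Longrightarrow> \<pi> g \<in> H"
    and retract_mult: "g \<in> carrier G \<Longrightarrow> g' \<in> carrier G \<Longrightarrow> \<pi> (g \<otimes> g') = \<pi> g \<otimes> \<pi> g'"
    and retract_id: "h \<in> H \<Longrightarrow> \<pi> h = h"
begin

definition \<Gamma> :: "'a set" where
  "\<Gamma> = {g \<in> carrier G. \<pi> g = \<one>}"

abbreviation (input) R :: "'s ring" where
  "R \<equiv> invariant_ring ring_of_type_algebra \<Gamma> act"

abbreviation (input) SH :: "('a \<Rightarrow> 's) ring" where
  "SH \<equiv> skew_group_ring ring_of_type_algebra (G\<lparr>carrier := H\<rparr>) act"

abbreviation (input) RH :: "('a \<Rightarrow> 's) ring" where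
  "RH \<equiv> skew_group_ring R (G\<lparr>carrier := H\<rparr>) act"

abbreviation (input) End :: "(('a \<Rightarrow> 's) \<Rightarrow> ('a \<Rightarrow> 's)) ring" where
  "End \<equiv> right_module_End SH RH (\<lambda>m a. m \<otimes>\<^bsub>SH\<^esub> a)"

lemma H_subset: "H \<subseteq> carrier G"
  by (rule subgroup.subset[OF subgroup_H])

lemma H_carrier: "h \<in> H \<Longrightarrow> h \<in> carrier G"
  using H_subset by blast

lemma finite_H: "finite H"
  using H_subset finite_carrier by (rule finite_subset)

lemma H_one: "\<one> \<in> H" and H_inv: "h \<in> H \<Longrightarrow> inv h \<in> H"
  and H_mult: "h \<in> H \<Longrightarrow> k \<in> H \<Longrightarrow> h \<otimes> k \<in> H"
  using subgroup_H by (auto simp: subgroup.one_closed subgroup.m_inv_closed subgroup.m_closed)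

lemmas H_closed = H_one H_inv H_mult H_carrier

lemma retract_carrier: "g \<in> carrier G \<Longrightarrow> \<pi> g \<in> carrier G"
  by (rule H_carrier[OF retract_closed])

lemma finite_ring_action_H: "finite_ring_action (G\<lparr>carrier := H\<rparr>) act"
proof -
  interpret H: group "G\<lparr>carrier := H\<rparr>"
    using subgroup_H by (rule subgroup.subgroup_is_group) (rule group_axioms)
  show ?thesis
    using H_subset finite_H
    by unfold_locales (auto simp: act_add act_mult act_unit act_comp act_id H_carrier)
qed

lemma SH_carrier: "carrier SH = H \<rightarrow>\<^sub>E UNIV"
  using finite_ring_action.skew_group_ring_carrier[OF finite_ring_action_H] by simp

lemma SH_add: "x \<oplus>\<^bsub>SH\<^esub> y = (\<lambda>k\<in>H. x k + y k)"
  using finite_ring_action.skew_group_ring_add[OF finite_ring_action_H] by simp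

lemma SH_mult: "x \<otimes>\<^bsub>SH\<^esub> y = (\<lambda>k\<in>H. \<Sum>g\<in>H. x g * act g (y (inv g \<otimes> k)))"
proof -
  have "inv\<^bsub>G\<lparr>carrier := H\<rparr>\<^esub> g = inv g" if "g \<in> H" for g
    using m_inv_consistent[OF subgroup_H that] .
  then show ?thesis
    using finite_ring_action.skew_group_ring_mult[OF finite_ring_action_H, of x y]
    by (auto simp: restrict_def fun_eq_iff intro!: sum.cong)
qed

lemma RH_carrier: "carrier RH = H \<rightarrow>\<^sub>E {r. \<forall>\<gamma>\<in>\<Gamma>. act \<gamma> r = r}"
  using finite_H by (auto simp: skew_group_ring_def invariant_ring_def)

lemma sum_translate_H:
  assumes "p \<in> H"
  shows "(\<Sum>k\<in>H. f (p \<otimes> k)) = (\<Sum>k\<in>H. f k)"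
proof (rule sum.reindex_bij_betw)
  show "bij_betw ((\<otimes>) p) H H"
    by (rule bij_betw_byWitness[where f' = "\<lambda>k. inv p \<otimes> k"])
       (use assms in \<open>auto simp: m_assoc[symmetric] H_closed\<close>)
qed

text \<open>The substitution \<open>p = h \<otimes> inv k\<close> passes from right translates, as
  produced by right linearity, to the left translates used in \<open>left_act\<close>.\<close>

lemma sum_quotient_H:
  assumes "h \<in> H"
  shows "(\<Sum>k\<in>H. f (h \<otimes> inv k) k) = (\<Sum>p\<in>H. f p (inv p \<otimes> h))"
proof (rule sum.reindex_bij_witness[where j = "\<lambda>k. h \<otimes> inv k" and i = "\<lambda>p. inv p \<otimes> h"])
  fix k assume k: "k \<in> H"
  then show "inv (h \<otimes> inv k) \<otimes> h = k"
    using assms by (simp add: inv_mult_group m_assoc H_carrier)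
  then show "f (h \<otimes> inv k) (inv (h \<otimes> inv k) \<otimes> h) = f (h \<otimes> inv k) k" by simp
  show "h \<otimes> inv k \<in> H" using k assms by (simp add: H_closed)
next
  fix p assume p: "p \<in> H"
  then show "h \<otimes> inv (inv p \<otimes> h) = p"
    using assms by (simp add: inv_mult_group m_assoc[symmetric] H_carrier)
  show "inv p \<otimes> h \<in> H" using p assms by (simp add: H_closed)
qed

text \<open>Unique factorization in a semidirect product; it splits a sum over the group according
  to the value of \<pi>.\<close>

lemma bij_H_\<Gamma>: "bij_betw (\<lambda>(p, \<gamma>). \<gamma> \<otimes> p) (H \<times> \<Gamma>) (carrier G)"
proof (rule bij_betw_byWitness[where f' = "\<lambda>g. (\<pi> g, g \<otimes> inv (\<pi> g))"])
  show "\<forall>a\<in>H \<times> \<Gamma>. (\<lambda>g. (\<pi> g, g \<otimes> inv (\<pi> g))) ((\<lambda>(p, \<gamma>). \<gamma> \<otimes> p) a) = a"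
    by (auto simp: \<Gamma>_def retract_mult retract_id H_carrier m_assoc)
  show "\<forall>a'\<in>carrier G. (\<lambda>(p, \<gamma>). \<gamma> \<otimes> p) (\<pi> a', a' \<otimes> inv (\<pi> a')) = a'"
    by (auto simp: m_assoc retract_carrier)
  show "(\<lambda>(p, \<gamma>). \<gamma> \<otimes> p) ` (H \<times> \<Gamma>) \<subseteq> carrier G"
    by (auto simp: \<Gamma>_def H_carrier)
  show "(\<lambda>g. (\<pi> g, g \<otimes> inv (\<pi> g))) ` carrier G \<subseteq> H \<times> \<Gamma>"
    by (auto simp: \<Gamma>_def retract_closed retract_carrier retract_mult retract_id H_closed)
qed

text \<open>As the kernel of \<pi>, \<Gamma> is normal, so the conjugate of \<gamma> by
  \<open>inv p\<close> again fixes \<open>r\<close>. Hence the whole group preserves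
  \<open>R\<close>.\<close>

lemma invariant_act:
  assumes "\<And>\<gamma>. \<gamma> \<in> \<Gamma> \<Longrightarrow> act \<gamma> r = r" "p \<in> carrier G" "\<gamma> \<in> \<Gamma>"
  shows "act \<gamma> (act p r) = act p r"
proof -
  have \<gamma>: "\<gamma> \<in> carrier G" using assms(3) by (simp add: \<Gamma>_def)
  have "\<pi> (inv p) \<otimes> \<pi> p = \<one>"
    using assms(2) by (metis H_one inv_closed l_inv retract_id retract_mult)
  then have "inv p \<otimes> \<gamma> \<otimes> p \<in> \<Gamma>"
    using assms(2,3) by (auto simp: \<Gamma>_def retract_mult retract_carrier)
  then have "act p (act (inv p \<otimes> \<gamma> \<otimes> p) r) = act p r" using assms(1) by simp
  then show ?thesis using assms(2) \<gamma> by (simp add: act_comp act_act_inv)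
qed

section \<open>The left action of the large skew group ring on the small one\<close>

text \<open>A term of \<open>x\<close> at \<open>k\<close> is moved by \<open>g\<close> to
  \<open>\<pi> g \<otimes> k\<close>, so the coefficient at \<open>h\<close> reads \<open>x\<close>
  at \<open>inv (\<pi> g) \<otimes> h\<close>.\<close>

definition left_act :: "('a \<Rightarrow> 's) \<Rightarrow> ('a \<Rightarrow> 's) \<Rightarrow> 'a \<Rightarrow> 's" where
  "left_act f = (\<lambda>x\<in>carrier SH. \<lambda>h\<in>H. \<Sum>g\<in>carrier G. f g * act g (x (inv (\<pi> g) \<otimes> h)))"

lemma left_act_apply:
  "x \<in> carrier SH \<Longrightarrow> h \<in> H \<Longrightarrow>
    left_act f x h = (\<Sum>g\<in>carrier G. f g * act g (x (inv (\<pi> g) \<otimes> h)))"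
  by (simp add: left_act_def)

lemma left_act_closed: "left_act f \<in> carrier SH \<rightarrow>\<^sub>E carrier SH"
  by (auto simp: left_act_def SH_carrier)

text \<open>The elements \<open>g\<close> and \<open>\<pi> g\<close> differ by an element of
  \<Gamma>, hence act alike on \<open>R\<close>. On the coefficients of \<open>a\<close> one may
  therefore use \<open>\<pi> g\<close>, and translating the sum over \<open>H\<close> absorbs
  it.\<close>

lemma left_act_right_linear:
  assumes x: "x \<in> carrier SH" and a: "a \<in> carrier RH"
  shows "left_act f (x \<otimes>\<^bsub>SH\<^esub> a) = left_act f x \<otimes>\<^bsub>SH\<^esub> a"
proof
  fix h
  have xa: "x \<otimes>\<^bsub>SH\<^esub> a \<in> carrier SH" by (simp add: SH_mult SH_carrier)
  show "left_act f (x \<otimes>\<^bsub>SH\<^esub> a) h = (left_act f x \<otimes>\<^bsub>SH\<^esub> a) h"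
  proof (cases "h \<in> H")
    case h: True
    have key: "act g (\<Sum>k\<in>H. x k * act k (a (inv k \<otimes> (inv (\<pi> g) \<otimes> h))))
        = (\<Sum>k\<in>H. act g (x (inv (\<pi> g) \<otimes> k)) * act k (a (inv k \<otimes> h)))"
      if g: "g \<in> carrier G" for g
    proof -
      let ?p = "\<pi> g"
      have p: "?p \<in> H" "?p \<in> carrier G" using g by (auto simp: retract_closed retract_carrier)
      have "act g (act k (a (inv k \<otimes> (inv ?p \<otimes> h)))) = act (?p \<otimes> k) (a (inv (?p \<otimes> k) \<otimes> h))"
        if k: "k \<in> H" for k
      proof -
        define r where "r = a (inv k \<otimes> (inv ?p \<otimes> h))"
        have "inv k \<otimes> (inv ?p \<otimes> h) \<in> H" using k h p by (simp add: H_closed)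
        then have r: "act \<gamma> r = r" if "\<gamma> \<in> \<Gamma>" for \<gamma>
          using a that unfolding r_def RH_carrier by (auto dest!: PiE_mem)
        have \<gamma>: "g \<otimes> inv ?p \<in> \<Gamma>"
          using g p by (auto simp: \<Gamma>_def retract_mult retract_id H_closed)
        have "g = (g \<otimes> inv ?p) \<otimes> ?p" using g p by (simp add: m_assoc)
        then have "act g (act k r) = act (g \<otimes> inv ?p) (act ?p (act k r))"
          using g p by (metis act_comp inv_closed m_closed)
        also have "\<dots> = act (?p \<otimes> k) r"
          using invariant_act[OF r, of "?p \<otimes> k" "g \<otimes> inv ?p"] \<gamma> p k
          by (simp add: act_comp H_carrier)
        finally show ?thesis
          using k p h by (simp add: r_def inv_mult_group m_assoc H_carrier)
      qed
      then have "act g (\<Sum>k\<in>H. x k * act k (a (inv k \<otimes> (inv ?p \<otimes> h))))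
          = (\<Sum>k\<in>H. act g (x k) * act (?p \<otimes> k) (a (inv (?p \<otimes> k) \<otimes> h)))"
        using g by (simp add: act_sum act_mult)
      \<comment> \<open>Written so that the summand depends on \<open>k\<close> only through
        \<open>?p \<otimes> k\<close>, ready for translation.\<close>
      also have "\<dots> = (\<Sum>k\<in>H. act g (x (inv ?p \<otimes> (?p \<otimes> k))) * act (?p \<otimes> k) (a (inv (?p \<otimes> k) \<otimes> h)))"
        using p by (intro sum.cong) (auto simp: m_assoc[symmetric] H_carrier)
      also have "\<dots> = (\<Sum>k\<in>H. act g (x (inv ?p \<otimes> k)) * act k (a (inv k \<otimes> h)))"
        by (rule sum_translate_H[OF p(1)])
      finally show ?thesis .
    qed
    have "left_act f (x \<otimes>\<^bsub>SH\<^esub> a) h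
        = (\<Sum>g\<in>carrier G. f g * act g (\<Sum>k\<in>H. x k * act k (a (inv k \<otimes> (inv (\<pi> g) \<otimes> h)))))"
      using h xa by (simp add: left_act_apply) (simp add: SH_mult H_closed retract_closed)
    also have "\<dots> = (\<Sum>k\<in>H. (\<Sum>g\<in>carrier G. f g * act g (x (inv (\<pi> g) \<otimes> k))) * act k (a (inv k \<otimes> h)))"
      by (simp add: key sum_distrib_left sum_distrib_right mult.assoc) (rule sum.swap)
    also have "\<dots> = (left_act f x \<otimes>\<^bsub>SH\<^esub> a) h"
      using h x by (simp add: SH_mult left_act_apply)
    finally show ?thesis .
  qed (use xa in \<open>simp add: left_act_def SH_mult\<close>)
qed

lemma left_act_End: "left_act f \<in> carrier End"
proof -
  have "left_act f (x \<oplus>\<^bsub>SH\<^esub> y) = left_act f x \<oplus>\<^bsub>SH\<^esub> left_act f y"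
    if xy: "x \<in> carrier SH" "y \<in> carrier SH" for x y
  proof
    fix h
    have "x \<oplus>\<^bsub>SH\<^esub> y \<in> carrier SH" by (simp add: SH_add SH_carrier)
    then show "left_act f (x \<oplus>\<^bsub>SH\<^esub> y) h = (left_act f x \<oplus>\<^bsub>SH\<^esub> left_act f y) h"
      using xy by (cases "h \<in> H")
        (simp_all add: left_act_def SH_add H_closed retract_closed act_add distrib_left sum.distrib)
  qed
  then show ?thesis
    using left_act_closed left_act_right_linear by (simp add: right_module_End_def)
qed

text \<open>Substituting \<open>g \<otimes> k\<close> for \<open>k\<close> separates the two
  factors; multiplicativity of \<pi> makes the shifts in \<open>H\<close> agree.\<close>

lemma left_act_mult:
  "left_act (f \<otimes>\<^bsub>SG\<^esub> f') = left_act f \<otimes>\<^bsub>End\<^esub> left_act f'"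
proof
  fix x
  show "left_act (f \<otimes>\<^bsub>SG\<^esub> f') x = (left_act f \<otimes>\<^bsub>End\<^esub> left_act f') x"
  proof (cases "x \<in> carrier SH")
    case x: True
    have "left_act (f \<otimes>\<^bsub>SG\<^esub> f') x h = left_act f (left_act f' x) h" for h
    proof (cases "h \<in> H")
      case h: True
      have key: "(\<Sum>k\<in>carrier G. act g (f' (inv g \<otimes> k)) * act k (x (inv (\<pi> k) \<otimes> h)))
          = act g (\<Sum>k\<in>carrier G. f' k * act k (x (inv (\<pi> k) \<otimes> (inv (\<pi> g) \<otimes> h))))"
        if g: "g \<in> carrier G" for g
      proof -
        have "(\<Sum>k\<in>carrier G. act g (f' (inv g \<otimes> k)) * act k (x (inv (\<pi> k) \<otimes> h)))
            = (\<Sum>k\<in>carrier G. act g (f' (inv g \<otimes> (g \<otimes> k))) * act (g \<otimes> k) (x (inv (\<pi> (g \<otimes> k)) \<otimes> h)))"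
          by (rule sum.reindex_bij_betw[OF bij_mult_left[OF g], symmetric])
        also have "\<dots> = (\<Sum>k\<in>carrier G. act g (f' k) * act g (act k (x (inv (\<pi> k) \<otimes> (inv (\<pi> g) \<otimes> h)))))"
          using g h
          by (intro sum.cong refl)
             (simp add: m_assoc[symmetric] act_comp retract_mult inv_mult_group retract_carrier H_carrier)
        finally show ?thesis using g by (simp add: act_sum act_mult)
      qed
      have "left_act (f \<otimes>\<^bsub>SG\<^esub> f') x h
          = (\<Sum>k\<in>carrier G. (\<Sum>g\<in>carrier G. f g * act g (f' (inv g \<otimes> k))) * act k (x (inv (\<pi> k) \<otimes> h)))"
        using h x by (simp add: left_act_apply skew_group_ring_mult)
      also have "\<dots> = (\<Sum>g\<in>carrier G. f g * (\<Sum>k\<in>carrier G. act g (f' (inv g \<otimes> k)) * act k (x (inv (\<pi> k) \<otimes> h))))"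
        by (simp add: sum_distrib_left sum_distrib_right mult.assoc) (rule sum.swap)
      also have "\<dots> = (\<Sum>g\<in>carrier G. f g * act g (left_act f' x (inv (\<pi> g) \<otimes> h)))"
        using h x by (simp add: key left_act_apply H_closed retract_closed)
      also have "\<dots> = left_act f (left_act f' x) h"
        using left_act_apply[OF PiE_mem[OF left_act_closed x] h] by simp
      finally show ?thesis .
    qed (use x PiE_mem[OF left_act_closed x] in \<open>simp add: left_act_def\<close>)
    then show ?thesis using x by (auto simp: right_module_End_def compose_def)
  qed (simp add: left_act_def right_module_End_def compose_def)
qed

lemma left_act_add:
  "left_act (f \<oplus>\<^bsub>SG\<^esub> f') = left_act f \<oplus>\<^bsub>End\<^esub> left_act f'"
  by (auto simp: fun_eq_iff left_act_def right_module_End_def SH_add skew_group_ring_add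
      distrib_right sum.distrib)

lemma left_act_one: "left_act \<one>\<^bsub>SG\<^esub> = \<one>\<^bsub>End\<^esub>"
proof -
  have "(\<lambda>h\<in>H. \<Sum>g\<in>carrier G. \<one>\<^bsub>SG\<^esub> g * act g (x (inv (\<pi> g) \<otimes> h))) = x" if "x \<in> carrier SH" for x
  proof
    fix h
    show "(\<lambda>h\<in>H. \<Sum>g\<in>carrier G. \<one>\<^bsub>SG\<^esub> g * act g (x (inv (\<pi> g) \<otimes> h))) h = x h"
    proof (cases "h \<in> H")
      case True
      have "(\<Sum>g\<in>carrier G. \<one>\<^bsub>SG\<^esub> g * act g (x (inv (\<pi> g) \<otimes> h)))
          = (\<Sum>g\<in>carrier G. if g = \<one> then x h else 0)"
        using True by (intro sum.cong refl)
          (auto simp: skew_group_ring_one retract_id H_one act_id H_carrier)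
      then show ?thesis using True finite_carrier by simp
    qed (use that in \<open>auto simp: SH_carrier\<close>)
  qed
  then show ?thesis by (auto simp: left_act_def right_module_End_def)
qed

section \<open>Recovering an endomorphism from its values on scalars\<close>

definition at_one :: "'s \<Rightarrow> 'a \<Rightarrow> 's" where
  "at_one s = (\<lambda>k\<in>H. if k = \<one> then s else 0)"

definition unit_at :: "'a \<Rightarrow> 'a \<Rightarrow> 's" where
  "unit_at p = (\<lambda>k\<in>H. if k = p then 1 else 0)"

lemma at_one_SH: "at_one s \<in> carrier SH"
  by (simp add: at_one_def SH_carrier)

lemma unit_at_RH: "unit_at p \<in> carrier RH"
  unfolding unit_at_def RH_carrier by (auto simp: \<Gamma>_def act_unit act_zero)

text \<open>A scalar on the right of the group element \<open>h\<close> is twisted by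
  \<open>h\<close> when moved to the left.\<close>

lemma mult_at_one:
  assumes "h \<in> H"
  shows "(y \<otimes>\<^bsub>SH\<^esub> at_one r) h = y h * act h r"
proof -
  have "inv g \<otimes> h = \<one> \<longleftrightarrow> g = h" if "g \<in> H" for g
    using that assms by (metis H_carrier inv_closed inv_equality inv_inv l_inv)
  then have "(\<Sum>g\<in>H. y g * act g (at_one r (inv g \<otimes> h)))
      = (\<Sum>g\<in>H. if g = h then y h * act h r else 0)"
    using assms by (intro sum.cong refl) (auto simp: at_one_def H_closed act_zero)
  then show ?thesis using assms finite_H by (simp add: SH_mult)
qed

lemma mult_unit_at:
  assumes "h \<in> H" "p \<in> H"
  shows "(y \<otimes>\<^bsub>SH\<^esub> unit_at p) h = y (h \<otimes> inv p)"
proof -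
  have "inv g \<otimes> h = p \<longleftrightarrow> g = h \<otimes> inv p" if "g \<in> H" for g
    using that assms by (metis H_carrier inv_solve_left inv_solve_right)
  then have "(\<Sum>g\<in>H. y g * act g (unit_at p (inv g \<otimes> h)))
      = (\<Sum>g\<in>H. if g = h \<otimes> inv p then y (h \<otimes> inv p) else 0)"
    using assms by (intro sum.cong refl) (auto simp: unit_at_def H_closed act_zero act_unit)
  then show ?thesis using assms finite_H by (simp add: SH_mult H_closed)
qed

context
  fixes \<phi> assumes \<phi>: "\<phi> \<in> carrier End"
begin

lemma End_closed: "x \<in> carrier SH \<Longrightarrow> \<phi> x \<in> carrier SH"
  and End_add: "x \<in> carrier SH \<Longrightarrow> y \<in> carrier SH \<Longrightarrow> \<phi> (x \<oplus>\<^bsub>SH\<^esub> y) = \<phi> x \<oplus>\<^bsub>SH\<^esub> \<phi> y"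
  and End_linear: "x \<in> carrier SH \<Longrightarrow> a \<in> carrier RH \<Longrightarrow> \<phi> (x \<otimes>\<^bsub>SH\<^esub> a) = \<phi> x \<otimes>\<^bsub>SH\<^esub> a"
  using \<phi> by (auto simp: right_module_End_def)

lemma End_sum:
  assumes "\<And>i. i \<in> A \<Longrightarrow> F i \<in> carrier SH" "finite A"
  shows "\<phi> (\<lambda>h\<in>H. \<Sum>i\<in>A. F i h) = (\<lambda>h\<in>H. \<Sum>i\<in>A. \<phi> (F i) h)"
  using assms(2,1)
proof (induction A rule: finite_induct)
  case empty
  have z: "(\<lambda>h\<in>H. 0) \<in> carrier SH" by (simp add: SH_carrier)
  have "\<phi> (\<lambda>h\<in>H. 0) = (\<lambda>h\<in>H. \<phi> (\<lambda>h\<in>H. 0) h + \<phi> (\<lambda>h\<in>H. 0) h)"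
    using End_add[OF z z] by (simp add: SH_add cong: restrict_cong)
  then have "\<phi> (\<lambda>h\<in>H. 0) h = 0" if "h \<in> H" for h
    using that by (metis (no_types, lifting) add_cancel_right_right restrict_apply')
  then show ?case
    using End_closed[OF z] by (auto simp: SH_carrier fun_eq_iff restrict_def PiE_def extensional_def)
next
  case (insert j A)
  let ?F = "\<lambda>h\<in>H. \<Sum>i\<in>A. F i h"
  have F: "?F \<in> carrier SH" by (simp add: SH_carrier)
  have "(\<lambda>h\<in>H. \<Sum>i\<in>insert j A. F i h) = F j \<oplus>\<^bsub>SH\<^esub> ?F"
    using insert.hyps by (auto simp: SH_add fun_eq_iff)
  then have "\<phi> (\<lambda>h\<in>H. \<Sum>i\<in>insert j A. F i h) = \<phi> (F j) \<oplus>\<^bsub>SH\<^esub> \<phi> ?F"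
    using End_add F insert.prems by simp
  also have "\<phi> ?F = (\<lambda>h\<in>H. \<Sum>i\<in>A. \<phi> (F i) h)"
    by (rule insert.IH) (rule insert.prems, rule insertI2)
  finally show ?case unfolding SH_add using insert.hyps by (auto simp: fun_eq_iff)
qed

text \<open>Write \<open>x\<close> as the sum of its coefficients times group elements. The latter
  lie in \<open>RH\<close>, so right linearity reduces \<phi> to its values on scalars.\<close>

lemma End_decompose:
  assumes x: "x \<in> carrier SH" and h: "h \<in> H"
  shows "\<phi> x h = (\<Sum>p\<in>H. \<phi> (at_one (x (inv p \<otimes> h))) p)"
proof -
  have cl: "y \<otimes>\<^bsub>SH\<^esub> z \<in> carrier SH" for y z by (simp add: SH_mult SH_carrier)
  have "(\<Sum>k\<in>H. (at_one (x k) \<otimes>\<^bsub>SH\<^esub> unit_at k) h') = x h'" if h': "h' \<in> H" for h'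
  proof -
    have "h' \<otimes> inv k = \<one> \<longleftrightarrow> k = h'" if "k \<in> H" for k
      using that h' by (metis H_carrier inv_closed inv_equality inv_inv r_inv)
    then have "(\<Sum>k\<in>H. (at_one (x k) \<otimes>\<^bsub>SH\<^esub> unit_at k) h') = (\<Sum>k\<in>H. if k = h' then x h' else 0)"
      using h' by (intro sum.cong refl) (auto simp: mult_unit_at at_one_def H_closed)
    then show ?thesis using h' finite_H by simp
  qed
  then have "(\<lambda>h\<in>H. \<Sum>k\<in>H. (at_one (x k) \<otimes>\<^bsub>SH\<^esub> unit_at k) h) = x"
    using x by (auto simp: SH_carrier fun_eq_iff restrict_def PiE_def extensional_def)
  then have "\<phi> x = (\<lambda>h\<in>H. \<Sum>k\<in>H. \<phi> (at_one (x k) \<otimes>\<^bsub>SH\<^esub> unit_at k) h)"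
    using End_sum[of H "\<lambda>k. at_one (x k) \<otimes>\<^bsub>SH\<^esub> unit_at k"] cl finite_H by simp
  then have "\<phi> x h = (\<Sum>k\<in>H. \<phi> (at_one (x k)) (h \<otimes> inv k))"
    using h by (simp add: End_linear at_one_SH unit_at_RH mult_unit_at cong: sum.cong)
  then show ?thesis
    using sum_quotient_H[OF h, of "\<lambda>p k. \<phi> (at_one (x k)) p"] by simp
qed

text \<open>Surjectivity of \<open>left_act\<close>: each coefficient map of \<phi>, suitably
  twisted, is linear over \<open>R\<close> and so expands over \<Gamma>; the expansions for all
  \<open>p\<close> in \<open>H\<close> assemble into one element of \<open>SG\<close>.\<close>

lemma End_eq_left_act:
  assumes maps: "\<And>\<psi>. (\<And>x y. \<psi> (x + y) = \<psi> x + \<psi> y) \<Longrightarrow>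
      (\<And>x r. (\<And>\<gamma>. \<gamma> \<in> \<Gamma> \<Longrightarrow> act \<gamma> r = r) \<Longrightarrow> \<psi> (x * r) = \<psi> x * r) \<Longrightarrow>
      \<exists>a. \<forall>s. \<psi> s = (\<Sum>g\<in>\<Gamma>. a g * act g s)"
  shows "\<exists>f\<in>carrier SG. \<phi> = left_act f"
proof -
  \<comment> \<open>Acting first by \<open>inv p\<close> cancels the twist from
    \<open>mult_at_one\<close>, which makes \<open>\<psi> p\<close> linear over
    \<open>R\<close>.\<close>
  define \<psi> where "\<psi> p s = \<phi> (at_one (act (inv p) s)) p" for p s
  have "\<exists>a. \<forall>s. \<psi> p s = (\<Sum>g\<in>\<Gamma>. a g * act g s)" if p: "p \<in> H" for p
  proof (rule maps)
    fix x y
    have "at_one (act (inv p) (x + y)) = at_one (act (inv p) x) \<oplus>\<^bsub>SH\<^esub> at_one (act (inv p) y)"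
      using p by (auto simp: at_one_def SH_add act_add H_carrier fun_eq_iff)
    then show "\<psi> p (x + y) = \<psi> p x + \<psi> p y"
      using p by (simp add: \<psi>_def End_add at_one_SH) (simp add: SH_add)
  next
    fix x r assume r: "\<And>\<gamma>. \<gamma> \<in> \<Gamma> \<Longrightarrow> act \<gamma> r = r"
    let ?q = "act (inv p)"
    have q: "inv p \<in> carrier G" using p by (simp add: H_carrier)
    have "at_one (?q r) \<in> carrier RH"
      using invariant_act[OF r q] unfolding at_one_def RH_carrier
      by (auto simp: \<Gamma>_def act_zero)
    moreover have "at_one (?q (x * r)) = at_one (?q x) \<otimes>\<^bsub>SH\<^esub> at_one (?q r)"
    proof
      fix h show "at_one (?q (x * r)) h = (at_one (?q x) \<otimes>\<^bsub>SH\<^esub> at_one (?q r)) h"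
        by (cases "h \<in> H") (auto simp: mult_at_one, auto simp: at_one_def SH_mult act_mult[OF q] act_id)
    qed
    ultimately show "\<psi> p (x * r) = \<psi> p x * r"
      using p by (simp add: \<psi>_def End_linear at_one_SH mult_at_one act_act_inv H_carrier)
  qed
  then obtain a where a: "\<And>p s. p \<in> H \<Longrightarrow> \<psi> p s = (\<Sum>g\<in>\<Gamma>. a p g * act g s)"
    by metis
  \<comment> \<open>The coefficient at \<open>\<gamma> \<otimes> p\<close> has to be
    \<open>a p \<gamma>\<close>; the two factors are recovered from \<pi>.\<close>
  define f where "f = (\<lambda>g\<in>carrier G. a (\<pi> g) (g \<otimes> inv (\<pi> g)))"
  have f: "f (\<gamma> \<otimes> p) = a p \<gamma>" if "p \<in> H" "\<gamma> \<in> \<Gamma>" for p \<gamma>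
    using that by (simp add: f_def \<Gamma>_def retract_mult retract_id H_carrier m_assoc)
  have "\<phi> x h = left_act f x h" if x: "x \<in> carrier SH" and h: "h \<in> H" for x h
  proof -
    have "left_act f x h
        = (\<Sum>(p, \<gamma>)\<in>H \<times> \<Gamma>. f (\<gamma> \<otimes> p) * act (\<gamma> \<otimes> p) (x (inv (\<pi> (\<gamma> \<otimes> p)) \<otimes> h)))"
      unfolding left_act_apply[OF x h] sum.reindex_bij_betw[OF bij_H_\<Gamma>, symmetric]
      by (simp add: case_prod_beta)
    also have "\<dots> = (\<Sum>p\<in>H. \<Sum>\<gamma>\<in>\<Gamma>. a p \<gamma> * act \<gamma> (act p (x (inv p \<otimes> h))))"
      unfolding sum.cartesian_product[symmetric]
      by (intro sum.cong refl)
         (auto simp: f, auto simp: \<Gamma>_def retract_mult retract_id act_comp H_carrier)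
    also have "\<dots> = (\<Sum>p\<in>H. \<psi> p (act p (x (inv p \<otimes> h))))"
      by (simp add: a)
    also have "\<dots> = \<phi> x h"
      by (simp add: \<psi>_def act_inv_act H_carrier End_decompose[OF x h])
    finally show ?thesis by simp
  qed
  then have apply_eq: "\<phi> x = left_act f x" if "x \<in> carrier SH" for x
    using End_closed[OF that] PiE_mem[OF left_act_closed that, of f] that unfolding SH_carrier
    by (intro PiE_ext)
  have "\<phi> = left_act f"
    by (rule PiE_ext[OF _ left_act_closed apply_eq]) (use \<phi> in \<open>simp_all add: right_module_End_def\<close>)
  moreover have "f \<in> carrier SG" by (simp add: f_def skew_group_ring_carrier)
  ultimately show ?thesis by blast
qed

end

text \<open>Independence of the group elements gives injectivity of \<open>left_act\<close>, and
  \<open>maps\<close> gives surjectivity.\<close>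

theorem End_iso_skew_group_ring:
  assumes independent: "\<And>d \<tau>. (\<And>s. (\<Sum>g\<in>carrier G. d g * act g s) = 0) \<Longrightarrow> \<tau> \<in> carrier G \<Longrightarrow> d \<tau> = 0"
    and maps: "\<And>\<psi>. (\<And>x y. \<psi> (x + y) = \<psi> x + \<psi> y) \<Longrightarrow>
      (\<And>x r. (\<And>\<gamma>. \<gamma> \<in> \<Gamma> \<Longrightarrow> act \<gamma> r = r) \<Longrightarrow> \<psi> (x * r) = \<psi> x * r) \<Longrightarrow>
      \<exists>a. \<forall>s. \<psi> s = (\<Sum>g\<in>\<Gamma>. a g * act g s)"
  shows "End \<simeq> SG"
proof (rule is_ring_iso_symI)
  have "inj_on left_act (carrier SG)"
  proof (rule inj_onI)
    fix f f' assume f: "f \<in> carrier SG" "f' \<in> carrier SG" and eq: "left_act f = left_act f'"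
    have "(\<Sum>g\<in>carrier G. (f g - f' g) * act g s) = 0" for s
    proof -
      \<comment> \<open>For a constant family the shift by \<open>\<pi> g\<close> is invisible, so
        evaluation at \<one> returns the operator on the base ring.\<close>
      let ?x = "\<lambda>h\<in>H. s"
      have x: "?x \<in> carrier SH" by (simp add: SH_carrier)
      have "left_act e ?x \<one> = (\<Sum>g\<in>carrier G. e g * act g s)" for e
        using left_act_apply[OF x H_one, of e] by (simp add: H_closed retract_closed)
      then show ?thesis using eq by (simp add: left_diff_distrib sum_subtractf) metis
    qed
    then have "f \<tau> - f' \<tau> = 0" if "\<tau> \<in> carrier G" for \<tau>
      using independent[of "\<lambda>g. f g - f' g"] that by blast
    then show "f = f'"
      using f unfolding skew_group_ring_carrier by (intro PiE_ext) auto
  qed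
  moreover have "left_act ` carrier SG = carrier End"
    using left_act_End End_eq_left_act[OF _ maps] by blast
  ultimately have "bij_betw left_act (carrier SG) (carrier End)" by (simp add: bij_betw_def)
  then show "left_act \<in> ring_iso SG End"
    by (intro ring_iso_memI left_act_End left_act_mult left_act_add left_act_one)
qed (simp_all add: skew_group_ring_carrier skew_group_ring_mult skew_group_ring_add skew_group_ring_one)

end

section \<open>Finite linear groups\<close>

text \<open>The matrix determinant lemma. If \<open>P\<close> has \<open>b\<close> as row
  \<open>k\<close>, then \<open>P\<close> intertwines the given matrix with the identity whose
  column \<open>k\<close> has \<open>P *v a\<close> subtracted; both auxiliary determinants are
  immediate.\<close>

lemma det_one_minus_outer:
  fixes a b :: "'a::field^'n"
  shows "det (\<chi> r c. (if r = c then 1 else 0) - a $ r * b $ c) = 1 - (\<Sum>s\<in>UNIV. b $ s * a $ s)"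
proof (cases "b = 0")
  case True
  have "det ((\<chi> r c. if r = c then 1 else 0) :: 'a^'n^'n) = 1"
    using det_I by (simp add: mat_def)
  then show ?thesis using True by simp
next
  case False
  then obtain k where k: "b $ k \<noteq> 0" by (auto simp: vec_eq_iff)
  let ?M = "(\<chi> r c. (if r = c then 1 else 0) - a $ r * b $ c) :: 'a^'n^'n"
  define P :: "'a^'n^'n" where "P = (\<chi> r c. if r = k then b $ c else if r = c then 1 else 0)"
  define x where "x = axis k 1 - P *v a"
  define N :: "'a^'n^'n" where "N = (\<chi> i j. if j = k then (mat 1 *v x) $ i else mat 1 $ i $ j)"
  have "P = (\<chi> i. if i = k then (\<Sum>i\<in>UNIV. b $ i *s row i (mat 1)) else row i (mat 1))"
    by (auto simp: P_def vec_eq_iff row_def mat_def if_distrib cong: if_cong)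
  then have "det P = b $ k * det (mat 1 :: 'a^'n^'n)"
    by (simp only: cramer_lemma_transpose)
  then have det_P: "det P = b $ k" by (simp add: det_I)
  have "det N = x $ k * det (mat 1 :: 'a^'n^'n)"
    unfolding N_def by (rule cramer_lemma)
  then have det_N: "det N = 1 - (\<Sum>s\<in>UNIV. b $ s * a $ s)"
    by (simp add: det_I x_def P_def matrix_vector_mult_def axis_def)
  have x_nth: "x $ r = (if r = k then 1 else 0) - (P *v a) $ r" for r
    by (auto simp: x_def axis_def)
  have N_nth: "N $ r $ s = (if s = k then x $ r else if r = s then 1 else 0)" for r s
    by (simp add: N_def) (simp add: mat_def)
  have "(P ** ?M) $ r $ c = (N ** P) $ r $ c" for r c
  proof -
    have "(P ** ?M) $ r $ c = (\<Sum>s\<in>UNIV. P $ r $ s * (if s = c then 1 else 0)) - (P *v a) $ r * b $ c"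
      by (simp add: matrix_matrix_mult_def matrix_vector_mult_def right_diff_distrib sum_subtractf
          sum_distrib_right mult.assoc)
    also have "\<dots> = P $ r $ c - (P *v a) $ r * b $ c"
      by (simp add: mult_delta_right)
    also have "\<dots> = (\<Sum>s\<in>UNIV. (if s = r then P $ s $ c else 0) - (if s = k then (P *v a) $ r * b $ c else 0))"
      by (simp add: sum_subtractf)
    also have "\<dots> = (N ** P) $ r $ c"
      unfolding matrix_matrix_mult_def
      by (simp, intro sum.cong refl) (auto simp: N_nth x_nth P_def left_diff_distrib)
    finally show ?thesis .
  qed
  then have "P ** ?M = N ** P" by (simp add: vec_eq_iff)
  then have "det (P ** ?M) = det (N ** P)" by (rule arg_cong)
  then have "det P * det ?M = det N * det P" by (simp only: det_mul)
  then show ?thesis using k by (simp add: det_P det_N)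
qed

text \<open>Rank at most one: a nonzero entry serves as pivot, and every row is a multiple of the
  pivot row.\<close>

lemma outer_product_of_minors_zero:
  fixes M :: "'a::field^'n^'m"
  assumes "\<And>i j c d. M $ i $ c * M $ j $ d = M $ j $ c * M $ i $ d"
  obtains a b where "\<And>i j. M $ i $ j = a $ i * b $ j"
proof (cases "M = 0")
  case True
  then show ?thesis using that[of 0 0] by simp
next
  case False
  then obtain r c where rc: "M $ r $ c \<noteq> 0" by (auto simp: vec_eq_iff)
  show ?thesis
    by (rule that[of "column c M" "\<chi> j. M $ r $ j / M $ r $ c"])
       (use rc assms[of _ c r] in \<open>auto simp: column_def field_simps\<close>)
qed

text \<open>A rank-one \<open>1 - g\<close> with \<open>det g = 1\<close> makes \<open>g\<close> a transvection, whose powers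
  \<open>1 - n (1 - g)\<close> are pairwise distinct.\<close>

lemma eq_mat_1_of_minors_zero:
  fixes g :: "complex^'n^'n"
  assumes "finite U" "mat 1 \<in> U" and closed: "\<And>h. h \<in> U \<Longrightarrow> h ** g \<in> U" and "det g = 1"
    and minors: "\<And>i j c d. (mat 1 - g) $ i $ c * (mat 1 - g) $ j $ d
      = (mat 1 - g) $ j $ c * (mat 1 - g) $ i $ d"
  shows "g = mat 1"
proof -
  obtain a b where ab: "\<And>i j. (mat 1 - g) $ i $ j = a $ i * b $ j"
    using outer_product_of_minors_zero[OF minors] by metis
  have g: "g $ i $ j = (if i = j then 1 else 0) - a $ i * b $ j" for i j
    using ab[of i j] by (auto simp: mat_def algebra_simps)
  then have "g = (\<chi> r c. (if r = c then 1 else 0) - a $ r * b $ c)" by (simp add: vec_eq_iff)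
  then have ba: "(\<Sum>s\<in>UNIV. b $ s * a $ s) = 0"
    using det_one_minus_outer[of a b] \<open>det g = 1\<close> by simp
  \<comment> \<open>The closed form of the powers of \<open>g\<close>: by \<open>ba\<close>, the
    square of \<open>mat 1 - g\<close> vanishes.\<close>
  define p :: "nat \<Rightarrow> complex^'n^'n" where
    "p n = (\<chi> r c. (if r = c then 1 else 0) - of_nat n * (a $ r * b $ c))" for n
  have p_Suc: "p n ** g = p (Suc n)" for n
  proof -
    have "(p n ** g) $ r $ c = p (Suc n) $ r $ c" for r c
    proof -
      have "(p n ** g) $ r $ c
          = (\<Sum>s\<in>UNIV. (if s = r then g $ s $ c else 0)
              - (if s = c then of_nat n * (a $ r * b $ s) else 0)
              + of_nat n * a $ r * b $ c * (b $ s * a $ s))"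
        unfolding matrix_matrix_mult_def p_def
        by (simp, intro sum.cong refl) (auto simp: g algebra_simps)
      also have "\<dots> = g $ r $ c - of_nat n * (a $ r * b $ c)
          + of_nat n * a $ r * b $ c * (\<Sum>s\<in>UNIV. b $ s * a $ s)"
        by (simp add: sum.distrib sum_subtractf sum_distrib_left)
      also have "\<dots> = p (Suc n) $ r $ c"
        unfolding ba by (simp add: g p_def algebra_simps)
      finally show ?thesis .
    qed
    then show ?thesis by (simp add: vec_eq_iff)
  qed
  have "p n \<in> U" for n
  proof (induction n)
    case 0
    have "p 0 = mat 1" by (simp add: p_def mat_def)
    then show ?case using assms(2) by simp
  qed (metis p_Suc closed)
  then have "range p \<subseteq> U" by blast
  then have "\<not> inj p" using \<open>finite U\<close> by (metis finite_imageD finite_subset infinite_UNIV_nat)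
  then obtain m n where "p m = p n" "m \<noteq> n" by (auto simp: inj_def)
  \<comment> \<open>Characteristic zero: distinct naturals stay distinct in the complex
    numbers.\<close>
  then have "a $ r * b $ c = 0" for r c
    by (simp add: p_def vec_eq_iff) (metis of_nat_eq_iff)
  then show ?thesis by (auto simp: vec_eq_iff g mat_def)
qed

section \<open>The general linear group and reflections\<close>

lemma invertible_mat_1: "invertible (mat 1 :: 'a::semiring_1^'n^'n)"
  unfolding invertible_def by (rule exI[of _ "mat 1"]) simp

lemma GL_simps [simp]:
  "carrier GL = {A. invertible A}" "A \<otimes>\<^bsub>GL\<^esub> B = A ** B" "\<one>\<^bsub>GL\<^esub> = mat 1"
  by (simp_all add: GL_def)

lemma group_GL: "group (GL :: (complex^'n^'n) monoid)"
proof (rule groupI)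
  fix A :: "complex^'n^'n" assume "A \<in> carrier GL"
  then obtain B where "A ** B = mat 1" "B ** A = mat 1" by (auto simp: invertible_def)
  then have "B \<in> carrier GL" "B \<otimes>\<^bsub>GL\<^esub> A = \<one>\<^bsub>GL\<^esub>" by (auto simp: invertible_def)
  then show "\<exists>B\<in>carrier GL. B \<otimes>\<^bsub>GL\<^esub> A = \<one>\<^bsub>GL\<^esub>" by blast
qed (auto simp: invertible_mult matrix_mul_assoc invertible_mat_1)

lemma is_reflection_det: "is_reflection A \<Longrightarrow> det A = -1"
  and is_reflection_square: "is_reflection A \<Longrightarrow> A ** A = mat 1"
proof -
  assume "is_reflection A"
  then obtain P :: "complex^'a^'a" and k where P: "invertible P"
    and A: "A = P ** (\<chi> i j. if i = j then (if i = k then -1 else 1) else 0) ** matrix_inv P"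
    by (auto simp: is_reflection_def)
  let ?D = "(\<chi> i j. if i = j then (if i = k then -1 else 1) else 0) :: complex^'a^'a"
  have inv: "P ** matrix_inv P = mat 1" "matrix_inv P ** P = mat 1"
    using P unfolding invertible_def matrix_inv_def by (metis (mono_tags, lifting) someI_ex)+
  have "det ?D = (\<Prod>i\<in>UNIV. if i = k then -1 else 1)"
    by (subst det_diagonal) auto
  then have "det ?D = -1" by simp
  moreover have "det P * det (matrix_inv P) = 1" using inv(1) by (metis det_I det_mul)
  ultimately show "det A = -1" unfolding A det_mul by (simp add: mult.commute)
  have "(\<Sum>c\<in>UNIV. ?D $ i $ c * ?D $ c $ j) = (\<Sum>c\<in>UNIV. if c = i then mat 1 $ i $ j else 0)" for i j
    by (intro sum.cong refl) (auto simp: mat_def)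
  then have "?D ** ?D = mat 1" by (simp add: vec_eq_iff matrix_matrix_mult_def)
  moreover have "A ** A = P ** (?D ** ((matrix_inv P ** P) ** ?D)) ** matrix_inv P"
    unfolding A by (simp add: matrix_mul_assoc)
  ultimately show "A ** A = mat 1" by (simp add: inv)
qed

lemma finite_domain_action_sym_act:
  fixes G :: "(complex^'n^'n) set"
  assumes "subgroup G GL" "finite G"
  shows "finite_domain_action (GL\<lparr>carrier := G\<rparr>) sym_act"
proof -
  interpret G: group "GL\<lparr>carrier := G\<rparr>"
    using assms(1) group_GL by (rule subgroup.subgroup_is_group)
  show ?thesis
    by unfold_locales
       (use assms(2) poly_mapping_no_zero_div in
         \<open>auto simp: sym_act_add sym_act_mult sym_act_compose sym_act_mat_1\<close>)
qed

text \<open>Translates the rank of \<open>mat 1 - g\<close> into independence of differences of the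
  form required by the codimension hypothesis.\<close>

lemma var_minus_sym_act: "var c - sym_act g (var c) = linear_form (column c (mat 1 - g))"
proof -
  have "column c (mat 1 - g) = axis c 1 - column c g"
    by (auto simp: vec_eq_iff column_def mat_def axis_def)
  then show ?thesis by (simp add: sym_act_var linear_form_diff linear_form_axis)
qed

section \<open>The isomorphism\<close>

theorem theorem5p1:
  fixes G H \<Gamma> :: "(complex^'n^'n) set"
    and \<sigma> :: "complex^'n^'n"
    and S R :: "'n sym ring"
    and SH RH SG :: "(complex^'n^'n \<Rightarrow> 'n sym) ring"
  assumes "subgroup G GL"
    and "finite G"
    and "generate GL {g \<in> G. is_reflection g} = G"
    and "\<sigma> \<in> G"
    and "is_reflection \<sigma>"
  defines "S \<equiv> ring_of_type_algebra"
    and "\<Gamma> \<equiv> G \<inter> SL"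
    and "R \<equiv> invariant_ring S \<Gamma> sym_act"
    and "H \<equiv> generate GL {\<sigma>}"
    and "SH \<equiv> skew_group_ring S (GL\<lparr>carrier := H\<rparr>) sym_act"
    and "RH \<equiv> skew_group_ring R (GL\<lparr>carrier := H\<rparr>) sym_act"
    and "SG \<equiv> skew_group_ring S (GL\<lparr>carrier := G\<rparr>) sym_act"
  shows "right_module_End SH RH (\<lambda>m a. m \<otimes>\<^bsub>SH\<^esub> a) \<simeq> SG"
proof -
  interpret GL: group "GL :: (complex^'n^'n) monoid" by (rule group_GL)
  have G_GL: "G \<subseteq> carrier GL" using assms(1) by (rule subgroup.subset)
  have G_one: "mat 1 \<in> G" and G_mult: "\<And>A B. A \<in> G \<Longrightarrow> B \<in> G \<Longrightarrow> A ** B \<in> G"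
    using subgroup.one_closed[OF assms(1)] subgroup.m_closed[OF assms(1)] by auto
  have \<sigma>_det: "det \<sigma> = -1" and \<sigma>_\<sigma>: "\<sigma> ** \<sigma> = mat 1"
    using assms(5) by (auto simp: is_reflection_det is_reflection_square)
  have involution_inv: "inv\<^bsub>GL\<^esub> A = A" if "A ** A = mat 1" for A :: "complex^'n^'n"
    using that by (intro GL.inv_equality) (auto simp: invertible_def)
  \<comment> \<open>Reflections generate \<open>G\<close>, so the determinant takes only two values
    and \<sigma> represents every coset outside \<Gamma>.\<close>
  have det_G: "det g = 1 \<or> det g = -1" if "g \<in> G" for g
  proof -
    have "g \<in> generate GL {g \<in> G. is_reflection g}" using that assms(3) by simp
    then show ?thesis
      by (induction rule: generate.induct)
         (auto simp: is_reflection_det is_reflection_square involution_inv det_mul)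
  qed
  have H_eq: "H = {mat 1, \<sigma>}"
  proof
    have "subgroup {mat 1, \<sigma>} GL"
      using assms(4) G_GL \<sigma>_\<sigma> by (intro GL.subgroupI) (auto simp: invertible_mat_1 involution_inv)
    then show "H \<subseteq> {mat 1, \<sigma>}"
      unfolding H_def by (intro GL.generate_subgroup_incl) auto
    show "{mat 1, \<sigma>} \<subseteq> H"
      unfolding H_def using generate.one[of GL "{\<sigma>}"] generate.incl[of \<sigma> "{\<sigma>}" GL] by simp
  qed
  let ?K = "GL\<lparr>carrier := G\<rparr>"
  interpret G: finite_domain_action ?K sym_act
    using assms(1,2) by (rule finite_domain_action_sym_act)
  \<comment> \<open>The determinant followed by the splitting that sends -1 to \<sigma>.\<close>
  define \<pi> where "\<pi> g = (if det g = 1 then mat 1 else \<sigma>)" for g :: "complex^'n^'n"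
  have "subgroup H GL" unfolding H_def using assms(4) G_GL by (intro GL.generate_is_subgroup) auto
  then have "subgroup H ?K"
    using assms(1,4) G_one by (intro GL.subgroup_incl) (auto simp: H_eq)
  then interpret E: semidirect_ring_action ?K sym_act H \<pi>
    by (intro semidirect_ring_action.intro G.finite_ring_action_axioms
        semidirect_ring_action_axioms.intro)
       (auto simp: \<pi>_def H_eq det_mul \<sigma>_det \<sigma>_\<sigma> dest!: det_G)
  \<comment> \<open>This makes the kernel of \<pi> exactly the determinant-one part.\<close>
  have "\<sigma> \<noteq> mat 1" using \<sigma>_det by auto
  then have \<Gamma>_eq: "E.\<Gamma> = \<Gamma>"
    by (auto simp: E.\<Gamma>_def \<Gamma>_def SL_def \<pi>_def)
  have sub_\<Gamma>: "subgroup \<Gamma> GL"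
  proof -
    have "\<Gamma> \<subseteq> carrier GL" using G_GL by (auto simp: \<Gamma>_def)
    moreover have "det (inv\<^bsub>GL\<^esub> A) = 1" if "A \<in> G" "det A = 1" for A
    proof -
      have "inv\<^bsub>GL\<^esub> A ** A = mat 1" using GL.l_inv[of A] that(1) G_GL by auto
      then have "det (inv\<^bsub>GL\<^esub> A) * det A = 1" by (metis det_I det_mul)
      then show ?thesis using that(2) by simp
    qed
    ultimately show ?thesis
      using subgroup.m_inv_closed[OF assms(1)] G_one G_mult
      by (intro GL.subgroupI) (auto simp: \<Gamma>_def SL_def det_mul det_I)
  qed
  interpret \<Gamma>: finite_domain_action "GL\<lparr>carrier := \<Gamma>\<rparr>" sym_act
    using sub_\<Gamma> assms(2) by (intro finite_domain_action_sym_act) (auto simp: \<Gamma>_def)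
  have faithful: "\<exists>p. sym_act g p \<noteq> p" if "g \<noteq> mat 1" for g :: "complex^'n^'n"
  proof -
    obtain i c where "(mat 1 - g) $ i $ c \<noteq> 0"
      using \<open>g \<noteq> mat 1\<close> by (metis right_minus_eq vec_eq_iff zero_index)
    then have "column c (mat 1 - g) \<noteq> 0" by (auto simp: vec_eq_iff column_def)
    then have "var c - sym_act g (var c) \<noteq> 0"
      by (simp add: var_minus_sym_act linear_form_eq_0_iff)
    then show ?thesis by (metis diff_self)
  qed
  have codim: "\<exists>x y. x - sym_act \<gamma> x \<noteq> 0 \<and>
      (\<forall>p q. p * (y - sym_act \<gamma> y) = q * (x - sym_act \<gamma> x) \<longrightarrow> x - sym_act \<gamma> x dvd p)"
    if \<gamma>: "\<gamma> \<in> \<Gamma>" "\<gamma> \<noteq> mat 1" for \<gamma>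
  proof -
    let ?M = "mat 1 - \<gamma>"
    have "\<gamma> \<in> G" "det \<gamma> = 1" using \<gamma>(1) by (auto simp: \<Gamma>_def SL_def)
    \<comment> \<open>If all two-by-two minors vanished, \<gamma> would be the identity. A nonzero
      one gives independent columns \<open>c\<close> and \<open>d\<close>, and the variables with
      these indices serve as witnesses.\<close>
    then obtain i j c d where minor: "?M $ i $ c * ?M $ j $ d \<noteq> ?M $ j $ c * ?M $ i $ d"
      using eq_mat_1_of_minors_zero[of G \<gamma>] \<gamma>(2) assms(2) G_one G_mult by blast
    let ?v = "column c ?M" and ?w = "column d ?M"
    have vw: "?v $ i * ?w $ j \<noteq> ?v $ j * ?w $ i" using minor by (simp add: column_def)
    then have "?v \<noteq> 0" by auto
    then have "var c - sym_act \<gamma> (var c) \<noteq> 0"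
      by (simp add: var_minus_sym_act linear_form_eq_0_iff)
    moreover have "var c - sym_act \<gamma> (var c) dvd p"
      if "p * (var d - sym_act \<gamma> (var d)) = q * (var c - sym_act \<gamma> (var c))" for p q
      using that vw unfolding var_minus_sym_act
      by (intro linear_form_dvd_of_mult_linear_form_eq[of ?v i ?w j p q])
    ultimately show ?thesis by blast
  qed
  have "right_module_End
      (skew_group_ring ring_of_type_algebra (?K\<lparr>carrier := H\<rparr>) sym_act)
      (skew_group_ring (invariant_ring ring_of_type_algebra \<Gamma> sym_act) (?K\<lparr>carrier := H\<rparr>) sym_act)
      (\<lambda>m a. m \<otimes>\<^bsub>skew_group_ring ring_of_type_algebra (?K\<lparr>carrier := H\<rparr>) sym_act\<^esub> a)
    \<simeq> skew_group_ring ring_of_type_algebra ?K sym_act"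
  proof (rule E.End_iso_skew_group_ring[unfolded \<Gamma>_eq])
    fix d \<tau> assume "\<And>s. (\<Sum>g\<in>carrier ?K. d g * sym_act g s) = 0" "\<tau> \<in> carrier ?K"
    then show "d \<tau> = 0" using faithful by (intro G.act_independent[of d \<tau>]) auto
  next
    fix \<psi> :: "'n sym \<Rightarrow> 'n sym"
    assume "\<And>x y. \<psi> (x + y) = \<psi> x + \<psi> y"
      "\<And>x r. (\<And>\<gamma>. \<gamma> \<in> \<Gamma> \<Longrightarrow> sym_act \<gamma> r = r) \<Longrightarrow> \<psi> (x * r) = \<psi> x * r"
    then obtain a where "\<And>s. \<psi> s = (\<Sum>g\<in>carrier (GL\<lparr>carrier := \<Gamma>\<rparr>). a g * sym_act g s)"
      using codim by (rule_tac \<Gamma>.invariant_linear_map_eq_sum_act[of \<psi>]) auto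
    then show "\<exists>a. \<forall>s. \<psi> s = (\<Sum>g\<in>\<Gamma>. a g * sym_act g s)" by auto
  qed
  then show ?thesis by (simp add: SH_def RH_def SG_def R_def S_def)
qed

end
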